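(* Let the design $\pi$ satisfy the infinite sampling assumption: for each $a\in[K]$, $N_T(a)\to\infty$ almost surely as $T\to\infty$, for any set of arm distributions $\{P_a\}_{a\in[K]}$. Assume the arm variances are finite. Furthermore, assume $\theta^*\in\Theta_0$, i.e. the true value of the target parameter $\theta=\mu_1$ is contained in the grid $\Theta_0$ of tested null values. Then, for any $\alpha\in[0,1]$, the confidence interval $\hat C(\alpha)$ converges almost surely to a zero-width set containing only $\theta^*$, and the point estimate $\hat\theta$ converges to $\theta^*$ almost surely, i.e. $$\lim_{T\to\infty}\lim_{B\to\infty}\hat C(\alpha)\to_{a.s.}\{\theta^*\},\qquad \lim_{T\to\infty}\lim_{B\to\infty}\hat\theta\to_{a.s.}\theta^*.$$
   Context: Bandit experiment. There are $K$ arms $[K]=\{1,\dots,K\}$; arm $a$ has outcome distribution $P_a$ on $\mathbb R$ with mean $\mu_a$. In rounds $t=1,2,\dots$, an arm $A_t$ is drawn from $\pi_t(H_{t-1})$, where $\pi_t$ is a known map from the history $H_{t-1}=(A_i,X_i)_{i=1}^{t-1}$ to probability distributions on $[K]$, and then an outcome $X_t$ is generated from $P_{A_t}$. The design is $\pi=\{\pi_t\}$. The experiment ends at time $T$, giving data $H_T=(A_i,X_i)_{i=1}^T$. Write $N_T(a)=\sum_{i=1}^T\mathbf 1[A_i=a]$ and $\hat\mu_T(a)=\frac1{N_T(a)}\sum_{i=1}^T\mathbf 1[A_i=a]X_i$. The target parameter is $\theta=\mu_1$, the mean of arm 1, with true value $\theta^*$. Trajectory simulation under null value $\theta_0$: nuisance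 parameters, namely the means of the arms other than arm 1 and the variances of all arms, are estimated from $H_T$, giving $\hat\mu_2,\dots,\hat\mu_K,\hat\sigma_1^2,\dots,\hat\sigma_K^2$. Then a new experiment of length $T$ is run with the same design $\pi$ applied to the simulated history, in which pulling arm $1$ yields an outcome drawn from $N(\theta_0,\hat\sigma_1^2)$ and pulling arm $a\neq1$ yields an outcome drawn from $N(\hat\mu_a,\hat\sigma_a^2)$. Simulation-based point-null test of $\theta=\theta_0$ with type I error level $\alpha$ and $B$ simulations: let $\rho(H_T)=\hat\mu_T(1)$ be the observed sample mean of arm 1. Generate $B$ trajectories $H_T^{(1)},\dots,H_T^{(B)}$ by the trajectory simulation under $\theta_0$, and let $\hat\rho^{(i)}=\rho(H_T^{(i)})$ be the sample mean of arm 1 in the $i$-th trajectory. Let $\hat F(\theta_0)=\frac1B\sum_{i=1}^B\mathbf 1[\hat\rho^{(i)}\le\rho(H_T)]$, the empirical CDF of the simulated statistics under null $\theta_0$ evaluated at the observed statistic. The decision is $\xi(\theta_0,H_T,\alpha)=1-\mathbf 1[\alpha/2\le\hat F(\theta_0)\le1-\alpha/2]$, with $1$ meaning rejection. Confidence interval and point estimate: given a grid $\Theta_0$ of target parameter values, the test is run for each $\theta_0\in\Theta_0$, and $\hat C(\alpha)=\{\rho(H_T)\}\cup\{\theta_0\in\Theta_0:\xi(\theta_0,H_T,\alpha)=0\}$, $\hat\theta=\arg\min_{\theta\in\hat C(\alpha)}|\hat F(\theta)-1/2|$.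
   Formalization: Proved for α in (0,1]: at α=0 the test never rejects, so Ĉ(0) contains all of Θ₀ and the claim fails unless Θ₀={θ*}. The grid Θ₀ is taken finite, and the inner limit over B is read as a limsup of the distance to θ*. *)

theory Defs
  imports "HOL-Probability.Probability"
begin

text \<open>
  Arms form a finite type and rounds are counted from 0: coordinate \<open>t\<close> of a history holds
  (arm, outcome) of round \<open>t + 1\<close>, and the first \<open>T\<close> rounds are the coordinates in \<open>{0..<T}\<close>.
\<close>

type_synonym 'k history = "nat \<Rightarrow> 'k \<times> real"

type_synonym 'k design = "nat \<Rightarrow> 'k history \<Rightarrow> 'k pmf"

abbreviation round_space :: "('k \<times> real) measure" where
  "round_space \<equiv> count_space UNIV \<Otimes>\<^sub>M borel"

abbreviation hist_space :: "nat \<Rightarrow> 'k history measure" where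
  "hist_space T \<equiv> PiM {0..<T} (\<lambda>_. round_space)"

definition is_design :: "'k design \<Rightarrow> bool" where
  "is_design \<pi> \<longleftrightarrow> (\<forall>t a. (\<lambda>h. pmf (\<pi> t h) a) \<in> borel_measurable (hist_space t))"

definition mean :: "real measure \<Rightarrow> real" where
  "mean D = (\<integral>x. x \<partial>D)"

definition finite_variance :: "real measure \<Rightarrow> bool" where
  "finite_variance D \<longleftrightarrow> integrable D (\<lambda>x. (x - mean D)\<^sup>2)"

definition arm_dists :: "('k \<Rightarrow> real measure) \<Rightarrow> bool" where
  "arm_dists P \<longleftrightarrow>
     (\<forall>a. prob_space (P a) \<and> sets (P a) = sets borel \<and> integrable (P a) (\<lambda>x. x))"

definition round_law :: "'k design \<Rightarrow> ('k \<Rightarrow> real measure) \<Rightarrow> nat \<Rightarrow> 'k history \<Rightarrow> ('k \<times> real) measure"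
  where "round_law \<pi> P t h = measure_pmf (\<pi> t h) \<bind> (\<lambda>a. distr (P a) round_space (Pair a))"

text \<open>
  The law of the length-\<open>T\<close> history: \<open>T\<close>-fold composition of the round kernels, started in
  the empty history (the constant \<open>undefined\<close>, the only point of \<open>hist_space 0\<close>).
\<close>

definition traj_law :: "'k design \<Rightarrow> ('k \<Rightarrow> real measure) \<Rightarrow> nat \<Rightarrow> 'k history measure" where
  "traj_law \<pi> P T =
     Ionescu_Tulcea.C (round_law \<pi> P) (\<lambda>_. round_space) 0 T (\<lambda>_. undefined)"

definition hist :: "(nat \<Rightarrow> 'w \<Rightarrow> 'k) \<Rightarrow> (nat \<Rightarrow> 'w \<Rightarrow> real) \<Rightarrow> nat \<Rightarrow> 'w \<Rightarrow> 'k history" where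
  "hist A X T \<omega> = (\<lambda>t\<in>{0..<T}. (A t \<omega>, X t \<omega>))"

definition bandit_experiment ::
  "'k design \<Rightarrow> ('k \<Rightarrow> real measure) \<Rightarrow> 'w measure \<Rightarrow> (nat \<Rightarrow> 'w \<Rightarrow> 'k) \<Rightarrow> (nat \<Rightarrow> 'w \<Rightarrow> real) \<Rightarrow> bool"
  where "bandit_experiment \<pi> P M A X \<longleftrightarrow>
    prob_space M \<and>
    (\<forall>t. A t \<in> M \<rightarrow>\<^sub>M count_space UNIV) \<and> (\<forall>t. X t \<in> borel_measurable M) \<and>
    (\<forall>T. distr M (hist_space T) (hist A X T) = traj_law \<pi> P T)"

definition pulls :: "'k \<Rightarrow> nat \<Rightarrow> 'k history \<Rightarrow> nat" where
  "pulls a T h = card {t \<in> {0..<T}. fst (h t) = a}"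

definition arm_mean :: "'k \<Rightarrow> nat \<Rightarrow> 'k history \<Rightarrow> real" where
  "arm_mean a T h = (\<Sum>t | t \<in> {0..<T} \<and> fst (h t) = a. snd (h t)) / real (pulls a T h)"

text \<open>Sample variance: divisor \<open>N\<close> for \<open>d = 0\<close>, and \<open>N - 1\<close> for \<open>d = 1\<close>.\<close>

definition arm_var :: "nat \<Rightarrow> 'k \<Rightarrow> nat \<Rightarrow> 'k history \<Rightarrow> real" where
  "arm_var d a T h =
     (\<Sum>t | t \<in> {0..<T} \<and> fst (h t) = a. (snd (h t) - arm_mean a T h)\<^sup>2)
       / (real (pulls a T h) - real d)"

text \<open>
  The experiments here live on the canonical sequence space, where one exists for every \<open>P\<close>
  (Ionescu-Tulcea); its law is determined by \<open>\<pi>\<close> and \<open>P\<close>.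
\<close>

definition infinite_sampling :: "'k design \<Rightarrow> bool" where
  "infinite_sampling \<pi> \<longleftrightarrow>
     (\<forall>P (Q :: 'k history measure).
        arm_dists P \<longrightarrow> bandit_experiment \<pi> P Q (\<lambda>t s. fst (s t)) (\<lambda>t s. snd (s t)) \<longrightarrow>
        (\<forall>a. AE s in Q. filterlim (\<lambda>T. pulls a T s) at_top sequentially))"

text \<open>Normal law with mean \<open>m\<close> and variance \<open>v\<close>, a point mass if \<open>v = 0\<close>.\<close>

definition normal_law :: "real \<Rightarrow> real \<Rightarrow> real measure" where
  "normal_law m v =
     (if v = 0 then return borel m else density lborel (\<lambda>x. ennreal (normal_density m (sqrt v) x)))"

definition sim_arms :: "nat \<Rightarrow> 'k \<Rightarrow> nat \<Rightarrow> real \<Rightarrow> 'k history \<Rightarrow> 'k \<Rightarrow> real measure" where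
  "sim_arms d a\<^sub>1 T \<theta>\<^sub>0 h a =
     normal_law (if a = a\<^sub>1 then \<theta>\<^sub>0 else arm_mean a T h) (arm_var d a T h)"

definition sim_law :: "'k design \<Rightarrow> nat \<Rightarrow> 'k \<Rightarrow> nat \<Rightarrow> real \<Rightarrow> 'k history \<Rightarrow> 'k history measure" where
  "sim_law \<pi> d a\<^sub>1 T \<theta>\<^sub>0 h = traj_law \<pi> (sim_arms d a\<^sub>1 T \<theta>\<^sub>0 h) T"

text \<open>
  Given the observed history \<open>H\<close> of length \<open>T\<close>, the trajectories \<open>S 0, S 1, \<dots>\<close> are i.i.d. from
  the simulation law under the null value \<open>g H\<close>. The null value may depend on the data because
  the test is also run at the observed mean, which always belongs to the confidence set.
\<close>

definition simulated ::
  "'k design \<Rightarrow> nat \<Rightarrow> 'k \<Rightarrow> nat \<Rightarrow> 'w measure \<Rightarrow> ('w \<Rightarrow> 'k history) \<Rightarrow> ('k history \<Rightarrow> real) \<Rightarrow>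
   (nat \<Rightarrow> 'w \<Rightarrow> 'k history) \<Rightarrow> bool"
  where "simulated \<pi> d a\<^sub>1 T M H g S \<longleftrightarrow>
    (\<forall>i. S i \<in> M \<rightarrow>\<^sub>M hist_space T) \<and>
    distr M (hist_space T \<Otimes>\<^sub>M PiM UNIV (\<lambda>_::nat. hist_space T)) (\<lambda>\<omega>. (H \<omega>, \<lambda>i. S i \<omega>)) =
    distr M (hist_space T) H \<bind>
      (\<lambda>h. distr (PiM UNIV (\<lambda>_::nat. sim_law \<pi> d a\<^sub>1 T (g h) h))
             (hist_space T \<Otimes>\<^sub>M PiM UNIV (\<lambda>_::nat. hist_space T)) (Pair h))"

text \<open>In the following, \<open>h\<close> is the observed history and \<open>s \<theta>\<^sub>0 i\<close> the \<open>i\<close>-th simulated one.\<close>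

definition Fhat :: "'k \<Rightarrow> nat \<Rightarrow> nat \<Rightarrow> 'k history \<Rightarrow> (real \<Rightarrow> nat \<Rightarrow> 'k history) \<Rightarrow> real \<Rightarrow> real" where
  "Fhat a\<^sub>1 T B h s \<theta>\<^sub>0 =
     (\<Sum>i<B. of_bool (arm_mean a\<^sub>1 T (s \<theta>\<^sub>0 i) \<le> arm_mean a\<^sub>1 T h)) / real B"

definition decision ::
  "'k \<Rightarrow> nat \<Rightarrow> nat \<Rightarrow> real \<Rightarrow> 'k history \<Rightarrow> (real \<Rightarrow> nat \<Rightarrow> 'k history) \<Rightarrow> real \<Rightarrow> nat" where
  "decision a\<^sub>1 T B \<alpha> h s \<theta>\<^sub>0 =
     1 - of_bool (\<alpha> / 2 \<le> Fhat a\<^sub>1 T B h s \<theta>\<^sub>0 \<and> Fhat a\<^sub>1 T B h s \<theta>\<^sub>0 \<le> 1 - \<alpha> / 2)"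

definition Chat ::
  "'k \<Rightarrow> nat \<Rightarrow> nat \<Rightarrow> real set \<Rightarrow> real \<Rightarrow> 'k history \<Rightarrow> (real \<Rightarrow> nat \<Rightarrow> 'k history) \<Rightarrow> real set" where
  "Chat a\<^sub>1 T B \<Theta>\<^sub>0 \<alpha> h s =
     {arm_mean a\<^sub>1 T h} \<union> {\<theta>\<^sub>0 \<in> \<Theta>\<^sub>0. decision a\<^sub>1 T B \<alpha> h s \<theta>\<^sub>0 = 0}"

text \<open>Hausdorff distance, meaningful for nonempty bounded sets.\<close>

definition hausdorff_dist :: "'a::metric_space set \<Rightarrow> 'a set \<Rightarrow> real" where
  "hausdorff_dist U V = max (SUP x\<in>U. infdist x V) (SUP y\<in>V. infdist y U)"

end

theory Submission
  imports Defs
begin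

text \<open>
  The observed mean of arm 1 lies in \<open>Chat\<close> and converges to the true mean, so it suffices that
  each wrong null value is eventually rejected, i.e. that under the simulation law the mean of
  arm 1 concentrates at the null value. Outcomes of successive pulls of one arm are i.i.d.
  (optional skipping), so this is a law of large numbers once arm 1 is pulled often. The simulated
  arms change with \<open>T\<close>, and infinite sampling gives no uniformity over arms; but the estimated
  normal arms converge in total variation to a limit, hence for fixed \<open>t\<^sub>0\<close> so does the
  law of the first \<open>t\<^sub>0\<close> rounds, and pull counts at time \<open>T \<ge> t\<^sub>0\<close> are at least those at
  \<open>t\<^sub>0\<close>. An arm of variance zero breaks total variation continuity, but is estimated exactly
  after its first pull.
\<close>

section \<open>The strong law of large numbers\<close>

text \<open>Letting B grow at fixed T collapses the simulation noise: \<open>Fhat\<close> becomes a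
  conditional distribution function evaluated at the observed mean. Only the data therefore need
  almost sure limits. Under the simulation law convergence in probability is enough, since this
  distribution function merely has to leave [\<alpha>/2, 1 - \<alpha>/2]. For a fixed path of the
  data the estimated arms form a deterministic sequence, and concentration and rejection are stated
  for such sequences. Total variation, rather than weak convergence, is dictated by the design:
  \<open>is_design\<close> asks for measurability only, so the choice of arms may jump under an
  arbitrarily small change of an outcome. The strong law is proved for all integrable functions
  because it is applied to the squared deviations as well, about which finite variance gives no more
  than integrability.\<close>

lemma distr_PiM_nat_shift:
  assumes "prob_space D"
  shows "distr (PiM UNIV (\<lambda>_::nat. D)) (PiM UNIV (\<lambda>_. D)) (\<lambda>s i. s (Suc i)) = PiM UNIV (\<lambda>_. D)"
  using distr_PiM_reindex[of UNIV "\<lambda>_. D" Suc UNIV] assms by (simp add: restrict_def)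

lemma distr_PiM_nat_component:
  assumes "prob_space D"
  shows "distr (PiM UNIV (\<lambda>_::nat. D)) D (\<lambda>s. s i) = D"
  using distr_PiM_component[of UNIV "\<lambda>_. D" i] assms by simp

lemma integrable_PiM_nat_component:
  fixes f :: "'a \<Rightarrow> real"
  assumes "prob_space D" "integrable D f"
  shows "integrable (PiM UNIV (\<lambda>_::nat. D)) (\<lambda>s. f (s i))"
    "(\<integral>s. f (s i) \<partial>PiM UNIV (\<lambda>_::nat. D)) = (\<integral>x. f x \<partial>D)"
proof -
  have [measurable]: "f \<in> borel_measurable D" using assms by auto
  have m: "(\<lambda>s. s i) \<in> PiM UNIV (\<lambda>_::nat. D) \<rightarrow>\<^sub>M D" by simp
  show "integrable (PiM UNIV (\<lambda>_::nat. D)) (\<lambda>s. f (s i))"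
    using integrable_distr[OF m, of f] assms by (simp add: distr_PiM_nat_component)
  show "(\<integral>s. f (s i) \<partial>PiM UNIV (\<lambda>_::nat. D)) = (\<integral>x. f x \<partial>D)"
    using integral_distr[OF m, of f] assms by (simp add: distr_PiM_nat_component)
qed

text \<open>The maximum of the first L partial sums and of the empty sum. The recursion peels off
  the first term instead of the last, so that the shifted sequence, whose law is the same, appears
  explicitly.\<close>

primrec max_sum :: "('a \<Rightarrow> real) \<Rightarrow> nat \<Rightarrow> (nat \<Rightarrow> 'a) \<Rightarrow> real" where
  "max_sum f 0 s = 0"
| "max_sum f (Suc L) s = max 0 (f (s 0) + max_sum f L (\<lambda>i. s (Suc i)))"

lemma max_sum_nonneg: "0 \<le> max_sum f L s"
  by (cases L) auto

lemma max_sum_mono: "max_sum f L s \<le> max_sum f (Suc L) s"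
proof (induction L arbitrary: s)
  case (Suc L)
  from Suc[of "\<lambda>i. s (Suc i)"] show ?case by auto
qed auto

lemma sum_le_max_sum: "n \<le> L \<Longrightarrow> (\<Sum>i<n. f (s i)) \<le> max_sum f L s"
proof (induction L arbitrary: n s)
  case (Suc L)
  show ?case
  proof (cases n)
    case (Suc m)
    have "(\<Sum>i<m. f (s (Suc i))) \<le> max_sum f L (\<lambda>i. s (Suc i))"
      using Suc Suc.prems by (intro Suc.IH) auto
    then show ?thesis by (simp add: Suc sum.lessThan_Suc_shift del: sum.lessThan_Suc)
  qed simp
qed auto

lemma integrable_max_sum:
  assumes D: "prob_space D" and f: "integrable D f"
  shows "integrable (PiM UNIV (\<lambda>_::nat. D)) (max_sum f L)"
proof (induction L)
  case (Suc L)
  have m: "(\<lambda>s i. s (Suc i)) \<in> PiM UNIV (\<lambda>_::nat. D) \<rightarrow>\<^sub>M PiM UNIV (\<lambda>_::nat. D)"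
    by (rule measurable_PiM_single') (auto simp: space_PiM)
  have "integrable (PiM UNIV (\<lambda>_::nat. D)) (\<lambda>s. max_sum f L (\<lambda>i. s (Suc i)))"
    by (rule integrable_distr[OF m]) (simp add: distr_PiM_nat_shift[OF D] Suc)
  then show ?case
    by (simp add: integrable_PiM_nat_component[OF D f] Bochner_Integration.integrable_max)
qed simp

text \<open>
  Garsia's argument: where \<open>max_sum g (Suc L) s\<close> is positive it exceeds \<open>max_sum g L\<close> at the
  shifted sequence by \<open>g (s 0)\<close>, and the shift preserves the measure.
\<close>

lemma maximal_ergodic:
  fixes f :: "'a \<Rightarrow> real"
  assumes D: "prob_space D" and f: "integrable D f" and pos: "\<And>x. x \<in> space D \<Longrightarrow> 0 \<le> f x" and l: "0 < l"
  shows "emeasure (PiM UNIV (\<lambda>_::nat. D))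
     {s \<in> space (PiM UNIV (\<lambda>_::nat. D)). \<exists>n\<ge>1. l * real n < (\<Sum>i<n. f (s i))} \<le> ennreal ((\<integral>x. f x \<partial>D) / l)"
    (is "emeasure ?M ?B \<le> _")
proof -
  interpret D: prob_space D by fact
  interpret M: prob_space ?M by (intro prob_space_PiM D)
  define g where "g x = f x - l" for x
  have fm[measurable]: "f \<in> borel_measurable D" using f by auto
  have g: "integrable D g" using f unfolding g_def by auto
  note ms = integrable_max_sum[OF D g]
  have [measurable]: "max_sum g L \<in> borel_measurable ?M" for L
    using ms[of L] by auto
  define E where "E L = {s \<in> space ?M. 0 < max_sum g L s}" for L
  have [measurable]: "E L \<in> sets ?M" for L unfolding E_def by measurable
  have m: "(\<lambda>s i. s (Suc i)) \<in> ?M \<rightarrow>\<^sub>M ?M"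
    by (rule measurable_PiM_single') (auto simp: space_PiM)
  have E_le: "emeasure ?M (E L) \<le> ennreal ((\<integral>x. f x \<partial>D) / l)" for L
  proof (cases L)
    case 0 then show ?thesis by (simp add: E_def)
  next
    case (Suc K)
    have int_shift: "integrable ?M (\<lambda>s. max_sum g K (\<lambda>i. s (Suc i)))"
      by (rule integrable_distr[OF m]) (simp add: distr_PiM_nat_shift[OF D] ms)
    have eq_shift: "(\<integral>s. max_sum g K (\<lambda>i. s (Suc i)) \<partial>?M) = (\<integral>s. max_sum g K s \<partial>?M)"
      using integral_distr[OF m, of "max_sum g K"] by (simp add: distr_PiM_nat_shift[OF D])
    have int_g: "integrable ?M (\<lambda>s. indicator (E L) s * g (s 0))"
      using integrable_real_mult_indicator[of "E L" ?M "\<lambda>s. g (s 0)"] integrable_PiM_nat_component(1)[OF D g, of 0]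
      by (simp add: mult.commute)
    have int_E: "integrable ?M (\<lambda>s. l * indicator (E L) s)"
      by (intro integrable_mult_right M.integrable_const_bound[of _ 1]) auto
    have "0 \<le> (\<integral>s. max_sum g L s \<partial>?M) - (\<integral>s. max_sum g K s \<partial>?M)"
      using ms by (simp add: Suc max_sum_mono integral_mono del: max_sum.simps)
    also have "\<dots> = (\<integral>s. max_sum g L s - max_sum g K (\<lambda>i. s (Suc i)) \<partial>?M)"
      using int_shift ms by (simp add: eq_shift del: max_sum.simps)
    \<comment> \<open>On \<open>E L\<close> the maximum with 0 is not attained at 0, so the
      difference equals \<open>g (s 0)\<close>; off \<open>E L\<close> it is 0 minus a nonnegative
      number.\<close>
    also have "\<dots> \<le> (\<integral>s. indicator (E L) s * g (s 0) \<partial>?M)"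
    proof (rule integral_mono)
      fix s assume "s \<in> space ?M"
      then show "max_sum g L s - max_sum g K (\<lambda>i. s (Suc i)) \<le> indicator (E L) s * g (s 0)"
        using max_sum_nonneg[of g K "\<lambda>i. s (Suc i)"] by (auto simp: Suc E_def indicator_def)
    qed (use int_g int_shift ms in \<open>auto simp del: max_sum.simps\<close>)
    \<comment> \<open>Since \<open>f\<close> is nonnegative, the indicator may be dropped in front
      of \<open>f\<close> while \<open>- l\<close> is kept on \<open>E L\<close>; this turns the
      inequality into a Markov bound for \<open>E L\<close>.\<close>
    also have "\<dots> \<le> (\<integral>s. f (s 0) - l * indicator (E L) s \<partial>?M)"
    proof (rule integral_mono)
      fix s assume "s \<in> space ?M"
      then have "0 \<le> f (s 0)" by (auto simp: space_PiM intro!: pos)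
      then show "indicator (E L) s * g (s 0) \<le> f (s 0) - l * indicator (E L) s"
        by (auto simp: indicator_def g_def)
    qed (use int_g int_E integrable_PiM_nat_component(1)[OF D f] in auto)
    also have "\<dots> = (\<integral>x. f x \<partial>D) - l * M.prob (E L)"
      using int_E integrable_PiM_nat_component[OF D f] by (subst Bochner_Integration.integral_diff) auto
    finally have "M.prob (E L) \<le> (\<integral>x. f x \<partial>D) / l"
      using l by (simp add: field_simps)
    then show ?thesis by (simp add: M.emeasure_eq_measure ennreal_leI)
  qed
  have "?B \<subseteq> (\<Union>L. E L)"
  proof
    fix s assume "s \<in> ?B"
    then obtain n where n: "s \<in> space ?M" "l * real n < (\<Sum>i<n. f (s i))" by auto
    then have "0 < (\<Sum>i<n. g (s i))" by (simp add: g_def sum_subtractf field_simps)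
    also have "\<dots> \<le> max_sum g n s" by (rule sum_le_max_sum) simp
    finally show "s \<in> (\<Union>L. E L)" using n by (auto simp: E_def)
  qed
  then have "emeasure ?M ?B \<le> emeasure ?M (\<Union>L. E L)"
    by (rule emeasure_mono) auto
  also have "\<dots> = (SUP L. emeasure ?M (E L))"
    by (rule SUP_emeasure_incseq[symmetric])
      (auto simp: incseq_Suc_iff E_def simp del: max_sum.simps intro: less_le_trans[OF _ max_sum_mono])
  also have "\<dots> \<le> ennreal ((\<integral>x. f x \<partial>D) / l)"
    by (rule SUP_least) (rule E_le)
  finally show ?thesis .
qed

text \<open>Countably many tolerances suffice, so almost sure convergence can be proved one
  tolerance at a time, and the set of convergence is visibly measurable.\<close>

lemma LIMSEQ_iff_inverse_Suc:
  fixes X :: "nat \<Rightarrow> real"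
  shows "X \<longlonglongrightarrow> l \<longleftrightarrow> (\<forall>k. \<forall>\<^sub>F n in sequentially. \<bar>X n - l\<bar> < 1 / real (Suc k))"
proof
  assume "X \<longlonglongrightarrow> l"
  then show "\<forall>k. \<forall>\<^sub>F n in sequentially. \<bar>X n - l\<bar> < 1 / real (Suc k)"
    using tendstoD[of X l sequentially] by (auto simp: dist_real_def)
next
  assume *: "\<forall>k. \<forall>\<^sub>F n in sequentially. \<bar>X n - l\<bar> < 1 / real (Suc k)"
  show "X \<longlonglongrightarrow> l"
  proof (rule tendstoI)
    fix e :: real assume "0 < e"
    then obtain k where k: "1 / real (Suc k) < e" using nat_approx_posE by blast
    from *[rule_format, of k] show "\<forall>\<^sub>F n in sequentially. dist (X n) l < e"
      by (rule eventually_mono) (use k in \<open>auto simp: dist_real_def\<close>)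
  qed
qed

lemma indep_vars_PiM_nat:
  assumes D: "prob_space D"
  shows "prob_space.indep_vars (PiM UNIV (\<lambda>_::nat. D)) (\<lambda>_. D) (\<lambda>i s. s i) UNIV"
proof -
  interpret M: prob_space "PiM UNIV (\<lambda>_::nat. D)" by (intro prob_space_PiM D)
  show ?thesis
    by (subst M.indep_vars_iff_distr_eq_PiM)
       (auto simp: restrict_def distr_PiM_nat_component[OF D] distr_id2)
qed

text \<open>Hoeffding's inequality makes the probabilities of a deviation by a fixed amount decay
  geometrically in n, so Borel-Cantelli applies.\<close>

lemma AE_PiM_bounded_average:
  fixes f :: "'a \<Rightarrow> real"
  assumes D: "prob_space D" and fm[measurable]: "f \<in> borel_measurable D" and bd: "\<And>x. x \<in> space D \<Longrightarrow> \<bar>f x\<bar> \<le> C"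
  shows "AE s in PiM UNIV (\<lambda>_::nat. D). (\<lambda>n. (\<Sum>i<n. f (s i)) / real n) \<longlonglongrightarrow> (\<integral>x. f x \<partial>D)"
proof -
  let ?M = "PiM UNIV (\<lambda>_::nat. D)"
  interpret D: prob_space D by fact
  interpret M: prob_space ?M by (intro prob_space_PiM D)
  \<comment> \<open>Hoeffding's inequality needs an interval of positive length, which
    \<open>C\<close> alone does not guarantee.\<close>
  define c where "c = max C 1"
  have c: "-c < c" "\<And>x. x \<in> space D \<Longrightarrow> f x \<in> {-c..c}"
    using bd unfolding c_def by (force simp: abs_le_iff)+
  have ind: "M.indep_vars (\<lambda>_. borel) (\<lambda>i s. f (s i)) {..<n}" for n
    by (rule M.indep_vars_subset[OF M.indep_vars_compose2[OF indep_vars_PiM_nat[OF D]]]) auto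
  have dist: "distr ?M borel (\<lambda>s. f (s i)) = distr ?M borel (\<lambda>s. f (s 0))" for i
  proof -
    have "distr ?M borel (\<lambda>s. f (s i)) = distr D borel f" for i
      using distr_distr[of f D borel "\<lambda>s. s i" ?M]
      by (simp add: distr_PiM_nat_component[OF D] comp_def)
    from this[of i] this[of 0] show ?thesis by simp
  qed
  have *: "AE s in ?M. \<forall>\<^sub>F n in sequentially. \<bar>(\<Sum>i<n. f (s i)) / real n - (\<integral>x. f x \<partial>D)\<bar> < 1 / real (Suc k)" for k
  proof -
    let ?e = "1 / real (Suc k)"
    define A where "A n = {s\<in>space ?M. \<bar>(\<Sum>i<n. f (s i)) / real n - (\<integral>x. f x \<partial>D)\<bar> \<ge> ?e}" for n
    have "M.prob (A n) \<le> 2 * exp (-2 * real n * ?e\<^sup>2 / (c - (-c))\<^sup>2)" if "n > 0" for n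
    proof -
      interpret H: Hoeffding_ineq_iid ?M "{..<n}" "\<lambda>i s. f (s i)" "\<lambda>s. f (s 0)" "-c" c
         "\<integral>s. f (s 0) \<partial>?M"
      proof (unfold_locales)
        show "distr ?M borel (\<lambda>s. f (s i)) = distr ?M borel (\<lambda>s. f (s 0))" for i by (rule dist)
        show "AE s in ?M. f (s 0) \<in> {-c..c}"
          by (rule AE_I2) (use c in \<open>auto simp: space_PiM\<close>)
      qed (auto intro: ind)
      have fi: "integrable D f"
        by (rule D.integrable_const_bound[where B=C]) (auto intro: bd)
      show ?thesis using H.Hoeffding_ineq_abs_ge'[of ?e] c that
        by (simp add: A_def integrable_PiM_nat_component[OF D fi] lessThan_empty_iff)
    qed
    moreover have "exp (-2 * real n * ?e\<^sup>2 / (c - (-c))\<^sup>2) = exp (-2 * ?e\<^sup>2 / (c - (-c))\<^sup>2) ^ n" for n :: nat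
      by (subst exp_of_nat_mult[symmetric]) (simp add: field_simps)
    ultimately have le: "M.prob (A n) \<le> 2 * exp (-2 * ?e\<^sup>2 / (c - (-c))\<^sup>2) ^ n" if "n > 0" for n
      using that by metis
    have [measurable]: "A n \<in> sets ?M" for n unfolding A_def by measurable
    have "AE s in ?M. eventually (\<lambda>n. s \<in> space ?M - A n) sequentially"
    proof (rule borel_cantelli_AE1)
      have "-2 * ?e\<^sup>2 / (c - (-c))\<^sup>2 < 0" using c(1) by (auto simp: divide_less_0_iff)
      then have "summable (\<lambda>n. 2 * exp (-2 * ?e\<^sup>2 / (c - (-c))\<^sup>2) ^ n)"
        by (intro summable_mult summable_geometric) simp
      then show "summable (\<lambda>n. M.prob (A n))"
        by (rule summable_comparison_test_ev[rotated])
          (use le in \<open>auto intro!: eventually_mono[OF eventually_gt_at_top[of 0]]\<close>)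
    qed (auto simp: M.emeasure_eq_measure)
    then show ?thesis
      by eventually_elim (auto elim!: eventually_mono simp: A_def)
  qed
  then show ?thesis
    unfolding LIMSEQ_iff_inverse_Suc AE_all_countable by simp
qed

text \<open>Truncation at C leaves a bounded part, covered by the previous lemma, and a remainder
  \<open>r C\<close> of small mean. The maximal inequality controls the averages of the remainder
  for all n simultaneously; a Markov bound for each n separately would not give an almost sure
  statement.\<close>

lemma strong_law_of_large_numbers:
  fixes f :: "'a \<Rightarrow> real"
  assumes D: "prob_space D" and f: "integrable D f"
  shows "AE s in PiM UNIV (\<lambda>_::nat. D). (\<lambda>n. (\<Sum>i<n. f (s i)) / real n) \<longlonglongrightarrow> (\<integral>x. f x \<partial>D)"
proof -
  let ?M = "PiM UNIV (\<lambda>_::nat. D)"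
  interpret D: prob_space D by fact
  interpret M: prob_space ?M by (intro prob_space_PiM D)
  have fm[measurable]: "f \<in> borel_measurable D" using f by auto
  define t where "t C x = (if \<bar>f x\<bar> \<le> real C then f x else 0)" for C :: nat and x
  define r where "r C x = \<bar>f x - t C x\<bar>" for C x
  have [measurable]: "t C \<in> borel_measurable D" "r C \<in> borel_measurable D" for C
    unfolding t_def r_def by measurable
  have ti: "integrable D (t C)" for C
    by (rule Bochner_Integration.integrable_bound[OF f]) (auto simp: t_def)
  have ri: "integrable D (r C)" for C unfolding r_def using ti f by auto
  have r0: "(\<lambda>C. \<integral>x. r C x \<partial>D) \<longlonglongrightarrow> 0"
  proof -
    have "(\<lambda>C. \<integral>x. r C x \<partial>D) \<longlonglongrightarrow> (\<integral>x. 0 \<partial>D)"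
    proof (rule integral_dominated_convergence[where w="\<lambda>x. \<bar>f x\<bar>"])
      show "AE x in D. (\<lambda>C. r C x) \<longlonglongrightarrow> 0"
      proof (rule AE_I2)
        fix x
        have "eventually (\<lambda>C. r C x = 0) sequentially"
          using eventually_ge_at_top[of "nat \<lceil>\<bar>f x\<bar>\<rceil>"] by eventually_elim (simp add: r_def t_def nat_le_iff ceiling_le_iff)
        then show "(\<lambda>C. r C x) \<longlonglongrightarrow> 0" by (rule tendsto_eventually)
      qed
    qed (use f in \<open>auto simp: r_def t_def\<close>)
    then show ?thesis by simp
  qed
  have key: "AE s in ?M. \<forall>\<^sub>F n in sequentially. \<bar>(\<Sum>i<n. f (s i)) / real n - (\<integral>x. f x \<partial>D)\<bar> < 3 * e" if e: "0 < e" for e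
  proof -
    have "\<forall>\<^sub>F C in sequentially. (\<integral>x. r C x \<partial>D) < e"
      using order_tendstoD(2)[OF r0 e] .
    then obtain C0 where C0: "\<And>C. C \<ge> C0 \<Longrightarrow> (\<integral>x. r C x \<partial>D) < e"
      by (auto simp: eventually_sequentially)
    \<comment> \<open>The event that every truncation level from \<open>C0\<close> on fails. Each
      level bounds its probability by the mean of \<open>r C\<close> divided by e, which tends to 0,
      so almost every sequence has a good level.\<close>
    define B where "B = {s \<in> space ?M. \<forall>C\<ge>C0. \<exists>n\<ge>1. e * real n < (\<Sum>i<n. r C (s i))}"
    have Bm[measurable]: "B \<in> sets ?M" unfolding B_def by measurable
    have "emeasure ?M B \<le> ennreal ((\<integral>x. r C x \<partial>D) / e)" if "C \<ge> C0" for C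
    proof -
      have "emeasure ?M B \<le> emeasure ?M {s \<in> space ?M. \<exists>n\<ge>1. e * real n < (\<Sum>i<n. r C (s i))}"
        by (rule emeasure_mono) (use that in \<open>auto simp: B_def\<close>)
      also have "\<dots> \<le> ennreal ((\<integral>x. r C x \<partial>D) / e)"
        by (rule maximal_ergodic[OF D ri _ e]) (auto simp: r_def)
      finally show ?thesis .
    qed
    moreover have "(\<lambda>C. ennreal ((\<integral>x. r C x \<partial>D) / e)) \<longlonglongrightarrow> ennreal (0 / e)"
      using r0 by (intro tendsto_ennrealI tendsto_divide) (use e in auto)
    ultimately have "emeasure ?M B \<le> 0"
      by (intro LIMSEQ_le_const[of "\<lambda>C. ennreal ((\<integral>x. r C x \<partial>D) / e)"]) auto
    then have "AE s in ?M. s \<notin> B" using Bm by (intro AE_not_in) (auto simp: null_sets_def)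
    moreover have "AE s in ?M. \<forall>C. (\<lambda>n. (\<Sum>i<n. t C (s i)) / real n) \<longlonglongrightarrow> (\<integral>x. t C x \<partial>D)"
      unfolding AE_all_countable
      by (intro allI AE_PiM_bounded_average[OF D]) (auto simp: t_def)
    ultimately show ?thesis using AE_space
    proof eventually_elim
      case (elim s)
      from elim obtain C where C: "C \<ge> C0" "\<And>n. n \<ge> 1 \<Longrightarrow> (\<Sum>i<n. r C (s i)) \<le> e * real n"
        unfolding B_def by (auto simp: not_less)
      have rt: "\<bar>(\<integral>x. t C x \<partial>D) - (\<integral>x. f x \<partial>D)\<bar> \<le> (\<integral>x. r C x \<partial>D)"
        using integral_abs_bound[of D "\<lambda>x. t C x - f x"] ti[of C] f
        by (simp add: r_def abs_minus_commute)
      have "\<forall>\<^sub>F n in sequentially. dist ((\<Sum>i<n. t C (s i)) / real n) (\<integral>x. t C x \<partial>D) < e"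
        using elim(2)[THEN spec, of C] e by (rule tendstoD)
      \<comment> \<open>Three errors of at most e add up to \<open>3 * e\<close>: the truncated
        average against its mean, the truncated mean against the full mean, and the average of the
        remainder.\<close>
      then show ?case using eventually_ge_at_top[of 1]
      proof eventually_elim
        case (elim n)
        have "(\<Sum>i<n. f (s i)) / real n - (\<Sum>i<n. t C (s i)) / real n = (\<Sum>i<n. f (s i) - t C (s i)) / real n"
          by (simp add: sum_subtractf diff_divide_distrib)
        also have "\<bar>\<dots>\<bar> \<le> (\<Sum>i<n. r C (s i)) / real n"
          by (auto simp: r_def intro!: divide_right_mono)
        also have "\<dots> \<le> e" using C(2)[of n] elim(2) by (simp add: field_simps)
        finally show ?case using elim(1) rt C0[OF C(1)] by (auto simp: dist_real_def)
      qed
    qed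
  qed
  have "AE s in ?M. \<forall>\<^sub>F n in sequentially. \<bar>(\<Sum>i<n. f (s i)) / real n - (\<integral>x. f x \<partial>D)\<bar> < 1 / real (Suc k)" for k
  proof -
    define e where "e = 1 / real (Suc k) / 3"
    have "x = 3 * (x / 3)" for x :: real by simp
    then have eq: "1 / real (Suc k) = 3 * e" unfolding e_def .
    have "0 < e" by (simp add: e_def)
    then show ?thesis unfolding eq by (rule key)
  qed
  then show ?thesis
    unfolding LIMSEQ_iff_inverse_Suc AE_all_countable by simp
qed

section \<open>Trajectory laws\<close>

text \<open>\<open>is_design\<close> speaks of the probabilities of single arms. With finitely many
  arms the probability of any event is a finite sum of these.\<close>

lemma measurable_design [measurable]:
  fixes \<pi> :: "'k::finite design"
  assumes "is_design \<pi>"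
  shows "(\<lambda>h. measure_pmf (\<pi> t h)) \<in> hist_space t \<rightarrow>\<^sub>M prob_algebra (count_space UNIV)"
proof (rule measurable_prob_algebraI[OF prob_space_measure_pmf measurable_subprob_algebra])
  have [measurable]: "(\<lambda>h. pmf (\<pi> t h) a) \<in> borel_measurable (hist_space t)" for a
    using assms unfolding is_design_def by auto
  show "(\<lambda>h. emeasure (measure_pmf (\<pi> t h)) A) \<in> borel_measurable (hist_space t)" for A
    by (simp add: emeasure_measure_pmf_finite)
qed (auto intro: prob_space_imp_subprob_space prob_space_measure_pmf)

text \<open>The arms carry a parameter x because simulated arms are computed from the observed
  history; joint measurability in x is what later makes \<open>sim_law\<close> a kernel.\<close>

lemma measurable_round_law:
  fixes \<pi> :: "'k::finite design"
  assumes d: "is_design \<pi>" and P: "\<And>a. (\<lambda>x. P x a) \<in> N \<rightarrow>\<^sub>M prob_algebra borel"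
  shows "(\<lambda>(x, h). round_law \<pi> (P x) t h) \<in> N \<Otimes>\<^sub>M hist_space t \<rightarrow>\<^sub>M prob_algebra round_space"
proof -
  note [measurable] = measurable_design[OF d, of t] P
  have 1: "(\<lambda>q. measure_pmf (\<pi> t (snd q))) \<in> N \<Otimes>\<^sub>M hist_space t \<rightarrow>\<^sub>M prob_algebra (count_space UNIV)"
    by measurable
  have 2: "(\<lambda>z. P (fst (fst z)) (snd z)) \<in> (N \<Otimes>\<^sub>M hist_space t) \<Otimes>\<^sub>M count_space UNIV \<rightarrow>\<^sub>M prob_algebra borel"
    by (rule measurable_compose_countable[where f="\<lambda>a z. P (fst (fst z)) a" and g=snd]) measurable
  have 3: "(\<lambda>z. distr (P (fst (fst z)) (snd z)) round_space (Pair (snd z)))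
     \<in> (N \<Otimes>\<^sub>M hist_space t) \<Otimes>\<^sub>M count_space UNIV \<rightarrow>\<^sub>M prob_algebra round_space"
    by (rule measurable_distr_prob_space2[OF 2]) measurable
  show ?thesis
    unfolding round_law_def split_beta'
    by (rule measurable_bind_prob_space2[OF 1]) (use 3 in \<open>simp add: split_beta'\<close>)
qed

lemma Ionescu_Tulcea_round_law:
  fixes \<pi> :: "'k::finite design"
  assumes d: "is_design \<pi>" and P: "\<And>a. P a \<in> space (prob_algebra borel)"
  shows "round_law \<pi> P t \<in> hist_space t \<rightarrow>\<^sub>M prob_algebra round_space"
    "Ionescu_Tulcea (round_law \<pi> P) (\<lambda>_. round_space)"
proof -
  show *: "round_law \<pi> P t \<in> hist_space t \<rightarrow>\<^sub>M prob_algebra round_space" for t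
  proof -
    have "(\<lambda>(x, h). round_law \<pi> P t h) \<in> (count_space UNIV :: unit measure) \<Otimes>\<^sub>M hist_space t \<rightarrow>\<^sub>M prob_algebra round_space"
      by (rule measurable_round_law[where P="\<lambda>_. P", OF d measurable_const[OF P]])
    from measurable_Pair2[OF this, of "()"] show ?thesis by simp
  qed
  show "Ionescu_Tulcea (round_law \<pi> P) (\<lambda>_. round_space)"
  proof (rule Ionescu_Tulcea.intro)
    show "round_law \<pi> P i \<in> hist_space i \<rightarrow>\<^sub>M subprob_algebra round_space" for i
      by (rule measurable_prob_algebraD[OF *])
    show "prob_space (round_law \<pi> P i x)" if "x \<in> space (hist_space i)" for i x
      using measurable_space[OF * that] by (simp add: space_prob_algebra)
  qed
qed

lemma traj_law_Suc:
  fixes \<pi> :: "'k::finite design"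
  assumes d: "is_design \<pi>" and P: "\<And>a. P a \<in> space (prob_algebra borel)"
  shows "traj_law \<pi> P (Suc t) =
    traj_law \<pi> P t \<bind> (\<lambda>h. distr (round_law \<pi> P t h) (hist_space (Suc t)) (fun_upd h t))"
proof -
  interpret IT: Ionescu_Tulcea "round_law \<pi> P" "\<lambda>_. round_space"
    by (rule Ionescu_Tulcea_round_law[where P=P, OF d P])
  show ?thesis by (simp add: traj_law_def IT.eP_def[abs_def])
qed

lemma traj_law_0:
  fixes \<pi> :: "'k::finite design"
  assumes d: "is_design \<pi>" and P: "\<And>a. P a \<in> space (prob_algebra borel)"
  shows "traj_law \<pi> P 0 = return (hist_space 0) (\<lambda>_. undefined)"
proof -
  interpret IT: Ionescu_Tulcea "round_law \<pi> P" "\<lambda>_. round_space"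
    by (rule Ionescu_Tulcea_round_law[where P=P, OF d P])
  show ?thesis by (simp add: traj_law_def)
qed

lemma measurable_hist_upd:
  "(\<lambda>(h, z). fun_upd h t z) \<in> hist_space t \<Otimes>\<^sub>M round_space \<rightarrow>\<^sub>M hist_space (Suc t)"
  unfolding split_beta'
  by (rule measurable_fun_upd[where J="{0..<t}"]) auto

lemma measurable_hist_upd_arm:
  "(\<lambda>(h, x). h(t := (a, x))) \<in> hist_space t \<Otimes>\<^sub>M borel \<rightarrow>\<^sub>M hist_space (Suc t)"
  unfolding split_beta'
  by (rule measurable_fun_upd[where J="{0..<t}"]) auto

lemma measurable_traj_law:
  fixes \<pi> :: "'k::finite design"
  assumes d: "is_design \<pi>" and P: "\<And>a. (\<lambda>x. P x a) \<in> N \<rightarrow>\<^sub>M prob_algebra borel"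
  shows "(\<lambda>x. traj_law \<pi> (P x) t) \<in> N \<rightarrow>\<^sub>M prob_algebra (hist_space t)"
proof (induction t)
  have Px: "P x a \<in> space (prob_algebra borel)" if "x \<in> space N" for x a
    using measurable_space[OF P that] .
  {
    case 0
    have "(\<lambda>_. undefined) \<in> space (hist_space 0)" by (simp add: space_PiM)
    then have "(\<lambda>x. return (hist_space 0) (\<lambda>_. undefined)) \<in> N \<rightarrow>\<^sub>M prob_algebra (hist_space 0)"
      by (intro measurable_const) (auto simp: space_prob_algebra intro: prob_space_return)
    then show ?case
      by (rule measurable_cong[THEN iffD1, rotated]) (rule traj_law_0[OF d, symmetric], rule Px)
  next
    case (Suc t)
    have rl: "(\<lambda>(x, h). round_law \<pi> (P x) t h) \<in> N \<Otimes>\<^sub>M hist_space t \<rightarrow>\<^sub>M prob_algebra round_space"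
      by (rule measurable_round_law[where P=P, OF d P])
    have "(\<lambda>x. traj_law \<pi> (P x) t \<bind> (\<lambda>h. distr (round_law \<pi> (P x) t h) (hist_space (Suc t)) (fun_upd h t)))
       \<in> N \<rightarrow>\<^sub>M prob_algebra (hist_space (Suc t))"
    proof (rule measurable_bind_prob_space2[OF Suc])
      have "(\<lambda>(x, y). fun_upd (snd x) t y) \<in> (N \<Otimes>\<^sub>M hist_space t) \<Otimes>\<^sub>M round_space \<rightarrow>\<^sub>M hist_space (Suc t)"
        unfolding split_beta' by (rule measurable_Pair_compose_split[OF measurable_hist_upd]) measurable
      then have "(\<lambda>q. distr (round_law \<pi> (P (fst q)) t (snd q)) (hist_space (Suc t)) (fun_upd (snd q) t))
          \<in> N \<Otimes>\<^sub>M hist_space t \<rightarrow>\<^sub>M prob_algebra (hist_space (Suc t))"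
        using rl by (intro measurable_distr_prob_space2[where f="\<lambda>q. fun_upd (snd q) t" and M=round_space])
          (simp_all add: split_beta')
      then show "(\<lambda>(x, h). distr (round_law \<pi> (P x) t h) (hist_space (Suc t)) (fun_upd h t))
          \<in> N \<Otimes>\<^sub>M hist_space t \<rightarrow>\<^sub>M prob_algebra (hist_space (Suc t))"
        by (simp add: split_beta')
    qed
    then show ?case
      by (rule measurable_cong[THEN iffD1, rotated]) (rule traj_law_Suc[OF d, symmetric], rule Px)
  }
qed

lemma traj_law_in_prob_algebra:
  fixes \<pi> :: "'k::finite design"
  assumes d: "is_design \<pi>" and P: "\<And>a. P a \<in> space (prob_algebra borel)"
  shows "traj_law \<pi> P t \<in> space (prob_algebra (hist_space t))"
proof -
  have "(\<lambda>_::unit. traj_law \<pi> P t) \<in> count_space UNIV \<rightarrow>\<^sub>M prob_algebra (hist_space t)"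
    by (rule measurable_traj_law[where P="\<lambda>_. P", OF d measurable_const[OF P]])
  from measurable_space[OF this, of "()"] show ?thesis by simp
qed

text \<open>Integrating out the last round turns the composed kernels into a finite sum over arms.
  Both the perturbation bound and the law of the next outcome are read off from this
  formula.\<close>

lemma nn_integral_traj_law_Suc:
  fixes \<pi> :: "'k::finite design"
  assumes d: "is_design \<pi>" and P: "\<And>a. P a \<in> space (prob_algebra borel)"
    and f[measurable]: "f \<in> borel_measurable (hist_space (Suc t))"
  shows "(\<integral>\<^sup>+s. f s \<partial>traj_law \<pi> P (Suc t)) =
    (\<integral>\<^sup>+h. (\<Sum>a\<in>UNIV. ennreal (pmf (\<pi> t h) a) * (\<integral>\<^sup>+x. f (h(t := (a, x))) \<partial>P a)) \<partial>traj_law \<pi> P t)"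
proof -
  note rl = Ionescu_Tulcea_round_law(1)[where P=P, OF d P, of t]
  have k: "(\<lambda>h. distr (round_law \<pi> P t h) (hist_space (Suc t)) (fun_upd h t)) \<in> hist_space t \<rightarrow>\<^sub>M prob_algebra (hist_space (Suc t))"
    by (rule measurable_distr_prob_space2[where f="\<lambda>h. fun_upd h t", OF rl measurable_hist_upd[of t]])
  have st: "sets (traj_law \<pi> P t) = sets (hist_space t)"
    using traj_law_in_prob_algebra[where P=P, OF d P] by (simp add: space_prob_algebra)
  have Pa: "sets (P a) = sets borel" "prob_space (P a)" for a using P[of a] by (auto simp: space_prob_algebra)
  have "(\<integral>\<^sup>+s. f s \<partial>traj_law \<pi> P (Suc t)) =
    (\<integral>\<^sup>+h. \<integral>\<^sup>+s. f s \<partial>distr (round_law \<pi> P t h) (hist_space (Suc t)) (fun_upd h t) \<partial>traj_law \<pi> P t)"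
    unfolding traj_law_Suc[where P=P, OF d P]
    by (rule nn_integral_bind[OF f]) (use measurable_prob_algebraD[OF k] in \<open>simp add: measurable_cong_sets[OF st refl]\<close>)
  also have "\<dots> = (\<integral>\<^sup>+h. (\<Sum>a\<in>UNIV. ennreal (pmf (\<pi> t h) a) * (\<integral>\<^sup>+x. f (h(t := (a, x))) \<partial>P a)) \<partial>traj_law \<pi> P t)"
  proof (rule nn_integral_cong)
    fix h assume "h \<in> space (traj_law \<pi> P t)"
    then have h: "h \<in> space (hist_space t)" using st sets_eq_imp_space_eq by blast
    have u[measurable]: "fun_upd h t \<in> round_space \<rightarrow>\<^sub>M hist_space (Suc t)"
      using measurable_Pair_compose_split[OF measurable_hist_upd[of t] measurable_const[OF h] measurable_ident] by simp
    have sr: "sets (round_law \<pi> P t h) = sets round_space"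
      using measurable_space[OF rl h] by (simp add: space_prob_algebra)
    have "(\<integral>\<^sup>+s. f s \<partial>distr (round_law \<pi> P t h) (hist_space (Suc t)) (fun_upd h t)) =
       (\<integral>\<^sup>+z. f (fun_upd h t z) \<partial>round_law \<pi> P t h)"
      by (rule nn_integral_distr) (simp_all add: u f measurable_cong_sets[OF sr refl])
    also have "\<dots> = (\<integral>\<^sup>+a. \<integral>\<^sup>+z. f (fun_upd h t z) \<partial>distr (P a) round_space (Pair a) \<partial>measure_pmf (\<pi> t h))"
      unfolding round_law_def
    proof (rule nn_integral_bind)
      show "(\<lambda>a. distr (P a) round_space (Pair a)) \<in> measure_pmf (\<pi> t h) \<rightarrow>\<^sub>M subprob_algebra round_space"
        by (auto simp: space_subprob_algebra measurable_cong_sets[OF Pa(1) refl]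
            intro!: prob_space_imp_subprob_space prob_space.prob_space_distr[OF Pa(2)])
      show "(\<lambda>z. f (fun_upd h t z)) \<in> borel_measurable round_space"
        by (rule measurable_compose[OF u f])
    qed
    also have "\<dots> = (\<integral>\<^sup>+a. \<integral>\<^sup>+x. f (h(t := (a, x))) \<partial>P a \<partial>measure_pmf (\<pi> t h))"
      by (intro nn_integral_cong nn_integral_distr)
        (use measurable_compose[OF u f] in \<open>auto simp: measurable_cong_sets[OF Pa(1) refl]\<close>)
    also have "\<dots> = (\<Sum>a\<in>UNIV. ennreal (pmf (\<pi> t h) a) * (\<integral>\<^sup>+x. f (h(t := (a, x))) \<partial>P a))"
      by (simp add: nn_integral_measure_pmf nn_integral_count_space_finite)
    finally show "(\<integral>\<^sup>+s. f s \<partial>distr (round_law \<pi> P t h) (hist_space (Suc t)) (fun_upd h t)) = \<dots>" .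
  qed
  finally show ?thesis .
qed

text \<open>
  Total variation closeness is inherited by trajectory laws, at a linear cost in the length.
  No continuity of the design is needed, as the same kernel acts on both sides.
\<close>

lemma nn_integral_traj_law_perturb:
  fixes \<pi> :: "'k::finite design"
  assumes d: "is_design \<pi>"
    and P: "\<And>a. P a \<in> space (prob_algebra borel)" and P': "\<And>a. P' a \<in> space (prob_algebra borel)"
    and close: "\<And>a g. g \<in> borel_measurable borel \<Longrightarrow> (\<And>x. g x \<le> 1) \<Longrightarrow>
       (\<integral>\<^sup>+x. g x \<partial>P a) \<le> (\<integral>\<^sup>+x. g x \<partial>P' a) + c"
    and f: "f \<in> borel_measurable (hist_space t)" "\<And>s. f s \<le> 1"
  shows "(\<integral>\<^sup>+s. f s \<partial>traj_law \<pi> P t) \<le> (\<integral>\<^sup>+s. f s \<partial>traj_law \<pi> P' t) + of_nat t * c"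
  using f
proof (induction t arbitrary: f)
  case 0
  then show ?case by (simp add: traj_law_0[where P=P, OF d P] traj_law_0[where P=P', OF d P'])
next
  case (Suc t)
  note [measurable] = Suc.prems(1)
  have m: "(\<lambda>h. \<Sum>a\<in>UNIV. ennreal (pmf (\<pi> t h) a) * (\<integral>\<^sup>+x. f (h(t := (a, x))) \<partial>P' a)) \<in> borel_measurable (hist_space t)"
    (is "?g \<in> _")
  proof -
    have [measurable]: "(\<lambda>h. pmf (\<pi> t h) a) \<in> borel_measurable (hist_space t)" for a
      using d unfolding is_design_def by auto
    have [measurable]: "(\<lambda>h. (\<integral>\<^sup>+x. f (h(t := (a, x))) \<partial>P' a)) \<in> borel_measurable (hist_space t)" for a
    proof -
      interpret prob_space "P' a" using P'[of a] by (simp add: space_prob_algebra)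
      have "(\<lambda>(h, x). f (h(t := (a, x)))) \<in> borel_measurable (hist_space t \<Otimes>\<^sub>M P' a)"
        using measurable_compose[OF measurable_hist_upd_arm[of t a] Suc.prems(1)] P'[of a]
        by (simp add: split_beta' space_prob_algebra fun_upd_def
            measurable_cong_sets[OF sets_pair_measure_cong[OF refl, of "P' a" borel] refl])
      then show ?thesis by (rule borel_measurable_nn_integral)
    qed
    show ?thesis by measurable
  qed
  have p1: "(\<Sum>a\<in>UNIV. ennreal (pmf (\<pi> t h) a)) = 1" for h
    using sum_pmf_eq_1[of UNIV "\<pi> t h"] by (simp add: sum_ennreal)
  have "(\<integral>\<^sup>+s. f s \<partial>traj_law \<pi> P (Suc t)) =
    (\<integral>\<^sup>+h. (\<Sum>a\<in>UNIV. ennreal (pmf (\<pi> t h) a) * (\<integral>\<^sup>+x. f (h(t := (a, x))) \<partial>P a)) \<partial>traj_law \<pi> P t)"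
    by (rule nn_integral_traj_law_Suc[where P=P, OF d P]) measurable
  \<comment> \<open>The weights of the arms sum to 1, so exchanging the outcome laws of the last
    round costs \<open>c\<close> only once.\<close>
  also have "\<dots> \<le> (\<integral>\<^sup>+h. ?g h + c \<partial>traj_law \<pi> P t)"
  proof (rule nn_integral_mono)
    fix h assume "h \<in> space (traj_law \<pi> P t)"
    then have h: "h \<in> space (hist_space t)"
      using traj_law_in_prob_algebra[where P=P, OF d P, of t] sets_eq_imp_space_eq by (auto simp: space_prob_algebra)
    have "(\<lambda>x. f (h(t := (a, x)))) \<in> borel_measurable borel" for a
      using measurable_compose[OF measurable_Pair_compose_split[OF measurable_hist_upd_arm[of t a] measurable_const[OF h] measurable_ident] Suc.prems(1)]
      by (simp add: fun_upd_def)
    then have "(\<Sum>a\<in>UNIV. ennreal (pmf (\<pi> t h) a) * (\<integral>\<^sup>+x. f (h(t := (a, x))) \<partial>P a)) \<le>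
      (\<Sum>a\<in>UNIV. ennreal (pmf (\<pi> t h) a) * ((\<integral>\<^sup>+x. f (h(t := (a, x))) \<partial>P' a) + c))"
      by (intro sum_mono mult_left_mono close) (auto intro: Suc.prems)
    also have "\<dots> = ?g h + (\<Sum>a\<in>UNIV. ennreal (pmf (\<pi> t h) a)) * c"
      by (simp only: distrib_left sum.distrib sum_distrib_right)
    finally show "(\<Sum>a\<in>UNIV. ennreal (pmf (\<pi> t h) a) * (\<integral>\<^sup>+x. f (h(t := (a, x))) \<partial>P a)) \<le> ?g h + c"
      by (simp add: p1)
  qed
  also have "\<dots> = (\<integral>\<^sup>+h. ?g h \<partial>traj_law \<pi> P t) + c"
  proof -
    have st: "sets (traj_law \<pi> P t) = sets (hist_space t)" and "prob_space (traj_law \<pi> P t)"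
      using traj_law_in_prob_algebra[where P=P, OF d P, of t] by (auto simp: space_prob_algebra)
    then show ?thesis using m
      by (subst nn_integral_add) (simp_all add: prob_space.emeasure_space_1 measurable_cong_sets[OF st refl])
  qed
  \<comment> \<open>With the last round integrated out under \<open>P'\<close>, the integrand
    \<open>?g\<close> is again bounded by 1, and the induction hypothesis replaces the earlier
    rounds.\<close>
  also have "\<dots> \<le> ((\<integral>\<^sup>+h. ?g h \<partial>traj_law \<pi> P' t) + of_nat t * c) + c"
  proof (rule add_right_mono, rule Suc.IH[OF m])
    fix h
    have "?g h \<le> (\<Sum>a\<in>UNIV. ennreal (pmf (\<pi> t h) a) * 1)"
    proof (intro sum_mono mult_left_mono)
      fix a
      interpret prob_space "P' a" using P'[of a] by (simp add: space_prob_algebra)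
      have "(\<integral>\<^sup>+x. f (h(t := (a, x))) \<partial>P' a) \<le> (\<integral>\<^sup>+x. 1 \<partial>P' a)"
        by (intro nn_integral_mono Suc.prems)
      then show "(\<integral>\<^sup>+x. f (h(t := (a, x))) \<partial>P' a) \<le> 1" by (simp add: emeasure_space_1)
    qed simp
    then show "?g h \<le> 1" by (simp add: p1)
  qed
  also have "(\<integral>\<^sup>+h. ?g h \<partial>traj_law \<pi> P' t) = (\<integral>\<^sup>+s. f s \<partial>traj_law \<pi> P' (Suc t))"
    by (rule nn_integral_traj_law_Suc[where P=P', OF d P', symmetric]) measurable
  finally show ?case by (simp add: algebra_simps)
qed

section \<open>Optional skipping\<close>

lemma arm_distsD:
  assumes "arm_dists P"
  shows "P a \<in> space (prob_algebra borel)" "sets (P a) = sets borel" "prob_space (P a)" "integrable (P a) (\<lambda>x. x)"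
  using assms by (auto simp: arm_dists_def space_prob_algebra)

lemma hist_canonical:
  "hist (\<lambda>t s. fst (s t)) (\<lambda>t s. snd (s t)) T = (\<lambda>s. restrict s {0..<T})"
  by (auto simp: hist_def fun_eq_iff restrict_def)

text \<open>\<open>infinite_sampling\<close> concerns experiments with infinite horizon, while
  simulated trajectories have length T. The Ionescu-Tulcea limit supplies an infinite experiment
  with the same arms, in which the finite one is embedded.\<close>

lemma ex_canonical_experiment:
  fixes \<pi> :: "'k::finite design"
  assumes d: "is_design \<pi>" and P: "arm_dists P"
  shows "\<exists>Q. sets Q = sets (PiM UNIV (\<lambda>_::nat. round_space :: ('k \<times> real) measure)) \<and>
    bandit_experiment \<pi> P Q (\<lambda>t s. fst (s t)) (\<lambda>t s. snd (s t))"
proof -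
  interpret IT: Ionescu_Tulcea "round_law \<pi> P" "\<lambda>_. round_space"
    by (rule Ionescu_Tulcea_round_law(2)[OF d]) (rule arm_distsD(1)[OF P])
  have st[measurable_cong]: "sets IT.PF.lim = sets (PiM UNIV (\<lambda>_::nat. round_space))"
    by (rule IT.PF.sets_lim)
  \<comment> \<open>\<open>IT.CI J\<close> runs the kernels up to the bound \<open>up_to J\<close>
    and then projects to J; for an initial segment nothing is projected away.\<close>
  have up: "IT.up_to {0..<T} = T" for T
  proof (rule antisym)
    show "IT.up_to {0..<T} \<le> T" by (simp add: IT.up_to_iff)
    show "T \<le> IT.up_to {0..<T}"
      using IT.up_to_less[of "{0..<T}" "IT.up_to {0..<T}"] by force
  qed
  have "IT.CI {0..<T} = traj_law \<pi> P T" for T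
    using IT.distr_C[of T T "\<lambda>_. undefined" 0] by (simp add: IT.CI_def up traj_law_def space_PiM)
  then have "distr IT.PF.lim (hist_space T) (hist (\<lambda>t s. fst (s t)) (\<lambda>t s. snd (s t)) T) = traj_law \<pi> P T" for T
    using IT.distr_lim[of "{0..<T}"] by (simp add: hist_canonical)
  moreover have "prob_space IT.PF.lim"
  proof (rule prob_space_distrD)
    have "prob_space (IT.CI {})" by (rule IT.PF.prob_space_P) auto
    then show "prob_space (distr IT.PF.lim (PiM {} (\<lambda>_. round_space)) (\<lambda>x. restrict x {}))"
      by (simp add: IT.distr_lim)
    show "(\<lambda>x. restrict x {}) \<in> IT.PF.lim \<rightarrow>\<^sub>M PiM {} (\<lambda>_. round_space)"
      using measurable_restrict_subset[OF subset_UNIV, of "{}" "\<lambda>_::nat. round_space"]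
      by (simp add: measurable_cong_sets[OF st refl])
  qed
  ultimately show ?thesis
    unfolding bandit_experiment_def by (intro exI[of _ IT.PF.lim]) (auto simp: st)
qed

text \<open>The data live on an arbitrary space \<open>M\<close>; pushing them forward to the
  sequence space puts them where \<open>infinite_sampling\<close> applies, and almost sure
  statements can be pulled back.\<close>

lemma bandit_experiment_seq:
  fixes \<pi> :: "'k::finite design"
  assumes e: "bandit_experiment \<pi> P M A X"
  defines "S \<equiv> (\<lambda>\<omega> t. (A t \<omega>, X t \<omega>))"
  shows "S \<in> M \<rightarrow>\<^sub>M PiM UNIV (\<lambda>_. round_space)"
    "bandit_experiment \<pi> P (distr M (PiM UNIV (\<lambda>_. round_space)) S) (\<lambda>t s. fst (s t)) (\<lambda>t s. snd (s t))"
proof -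
  have [measurable]: "A t \<in> M \<rightarrow>\<^sub>M count_space UNIV" "X t \<in> borel_measurable M" for t
    using e by (auto simp: bandit_experiment_def)
  show S[measurable]: "S \<in> M \<rightarrow>\<^sub>M PiM UNIV (\<lambda>_. round_space)"
    unfolding S_def by (rule measurable_PiM_single') (auto simp: space_PiM space_pair_measure)
  have r: "(\<lambda>s. restrict s {0..<T}) \<in> PiM UNIV (\<lambda>_. round_space) \<rightarrow>\<^sub>M hist_space T" for T :: nat
    by (rule measurable_restrict_subset) simp
  have "distr (distr M (PiM UNIV (\<lambda>_. round_space)) S) (hist_space T) (\<lambda>s. restrict s {0..<T}) =
     distr M (hist_space T) (hist A X T)" for T
    by (subst distr_distr[OF r S]) (auto simp: comp_def hist_def S_def restrict_def intro!: distr_cong)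
  then show "bandit_experiment \<pi> P (distr M (PiM UNIV (\<lambda>_. round_space)) S) (\<lambda>t s. fst (s t)) (\<lambda>t s. snd (s t))"
    using e S by (auto simp: bandit_experiment_def hist_canonical intro!: prob_space.prob_space_distr)
qed

section \<open>Pull counts and the reward sequence along a fixed path\<close>

lemma pulls_0 [simp]: "pulls a 0 s = 0"
  by (simp add: pulls_def)

lemma pulls_Suc: "pulls a (Suc t) s = pulls a t s + of_bool (fst (s t) = a)"
proof -
  have "{i \<in> {0..<Suc t}. fst (s i) = a} = {i \<in> {0..<t}. fst (s i) = a} \<union> (if fst (s t) = a then {t} else {})"
    by (auto simp: less_Suc_eq)
  then show ?thesis by (simp add: pulls_def)
qed

lemma pulls_mono: "t \<le> t' \<Longrightarrow> pulls a t s \<le> pulls a t' s"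
  unfolding pulls_def by (rule card_mono) auto

lemma pulls_less:
  assumes "fst (s i) = a" "i < t"
  shows "pulls a i s < pulls a t s"
  using pulls_Suc[of a i s] pulls_mono[of "Suc i" t a s] assms by simp

text \<open>The count grows by at most one per round, so it passes through every smaller value, and
  it leaves that value exactly at a pull.\<close>

lemma ex_pull: "n < pulls a t s \<Longrightarrow> \<exists>i<t. fst (s i) = a \<and> pulls a i s = n"
proof (induction t)
  case (Suc t)
  then show ?case
    by (cases "n < pulls a t s") (auto simp: pulls_Suc less_Suc_eq of_bool_def split: if_splits)
qed simp

lemma pulls_cong: "(\<And>i. i < t \<Longrightarrow> s i = s' i) \<Longrightarrow> pulls a t s = pulls a t s'"
  unfolding pulls_def by (rule arg_cong[where f=card]) auto

text \<open>Pulls are counted from 0; both values are junk if \<open>a\<close> is pulled at most \<open>n\<close> times.\<close>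

definition pull_time :: "'k \<Rightarrow> nat \<Rightarrow> 'k history \<Rightarrow> nat" where
  "pull_time a n s = (LEAST t. fst (s t) = a \<and> pulls a t s = n)"

definition reward :: "'k \<Rightarrow> nat \<Rightarrow> 'k history \<Rightarrow> real" where
  "reward a n s = snd (s (pull_time a n s))"

lemma reward_pulls: "fst (s t) = a \<Longrightarrow> reward a (pulls a t s) s = snd (s t)"
proof -
  assume a: "fst (s t) = a"
  have "pull_time a (pulls a t s) s = t"
    unfolding pull_time_def
  proof (rule Least_equality)
    fix i assume "fst (s i) = a \<and> pulls a i s = pulls a t s"
    then show "t \<le> i" using pulls_less[of s i a t] by (cases "i < t") auto
  qed (use a in simp)
  then show ?thesis by (simp add: reward_def)
qed

text \<open>Sums over the rounds of an arm become partial sums of its rewards, with the pull count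
  as a random upper index; this is the form to which the strong law applies.\<close>

lemma sum_pulled:
  fixes g :: "real \<Rightarrow> 'b::comm_monoid_add"
  shows "(\<Sum>t | t \<in> {0..<T} \<and> fst (s t) = a. g (snd (s t))) = (\<Sum>n<pulls a T s. g (reward a n s))"
proof (induction T)
  case (Suc T)
  have "{i. i \<in> {0..<Suc T} \<and> fst (s i) = a} = {i. i \<in> {0..<T} \<and> fst (s i) = a} \<union> (if fst (s T) = a then {T} else {})"
    by (auto simp: less_Suc_eq)
  then show ?case
    using Suc by (auto simp: pulls_Suc reward_pulls add.commute)
qed simp

text \<open>The index set J is left open so that histories of fixed length and infinite sequences
  are both covered.\<close>

lemma measurable_pulls [measurable]:
  "{0..<t} \<subseteq> J \<Longrightarrow> pulls a t \<in> PiM J (\<lambda>_. round_space) \<rightarrow>\<^sub>M count_space UNIV"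
proof (induction t)
  case (Suc t)
  then have [measurable]: "pulls a t \<in> PiM J (\<lambda>_. round_space) \<rightarrow>\<^sub>M count_space UNIV" by (auto simp: subset_eq)
  have "t \<in> J" using Suc by auto
  then have [measurable]: "(\<lambda>s. s t) \<in> PiM J (\<lambda>_. round_space) \<rightarrow>\<^sub>M round_space" by simp
  have "(\<lambda>s. pulls a t s + of_bool (fst (s t) = a)) \<in> PiM J (\<lambda>_. round_space) \<rightarrow>\<^sub>M count_space UNIV"
    by measurable
  then show ?case by (simp add: pulls_Suc[abs_def])
qed (simp add: pulls_def[abs_def])

lemma measurable_reward [measurable]:
  "reward a n \<in> borel_measurable (PiM UNIV (\<lambda>_. round_space))"
proof -
  have [measurable]: "pull_time a n \<in> PiM UNIV (\<lambda>_. round_space) \<rightarrow>\<^sub>M count_space UNIV"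
    unfolding pull_time_def[abs_def] by measurable auto
  show ?thesis
    unfolding reward_def[abs_def]
    by (rule measurable_compose_countable[where f="\<lambda>i s. snd (s i)"]) measurable
qed

text \<open>Instantiated three times: with the arms that generate the data, with the limit of the
  simulated arms, and with the simulated arms of each large horizon T.\<close>

locale canonical_experiment =
  fixes \<pi> :: "'k::finite design" and P :: "'k \<Rightarrow> real measure" and Q :: "'k history measure"
  assumes design: "is_design \<pi>" and sampling: "infinite_sampling \<pi>" and arms: "arm_dists P"
    and sets_Q [measurable_cong]: "sets Q = sets (PiM UNIV (\<lambda>_. round_space))"
    and bandit: "bandit_experiment \<pi> P Q (\<lambda>t s. fst (s t)) (\<lambda>t s. snd (s t))"
begin

sublocale prob_space Q
  using bandit by (simp add: bandit_experiment_def)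

lemma space_Q [simp]: "space Q = UNIV"
  using sets_eq_imp_space_eq[OF sets_Q] by (simp add: space_PiM space_pair_measure)

lemma pulls_at_top: "AE s in Q. filterlim (\<lambda>T. pulls a T s) at_top sequentially"
  using sampling arms bandit unfolding infinite_sampling_def by blast

lemma measurable_restrict_hist [measurable]: "(\<lambda>s. restrict s {0..<T}) \<in> Q \<rightarrow>\<^sub>M hist_space T"
proof -
  have "(\<lambda>s. restrict s {0..<T}) \<in> PiM UNIV (\<lambda>_. round_space) \<rightarrow>\<^sub>M hist_space T"
    by (rule measurable_restrict_subset) simp
  then show ?thesis by (simp add: measurable_cong_sets[OF sets_Q refl])
qed

lemma distr_restrict_hist: "distr Q (hist_space T) (\<lambda>s. restrict s {0..<T}) = traj_law \<pi> P T"
  using bandit by (simp add: bandit_experiment_def hist_canonical)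

lemma emeasure_traj_law:
  assumes "E \<in> sets (hist_space T)"
  shows "emeasure (traj_law \<pi> P T) E = emeasure Q {s. restrict s {0..<T} \<in> E}"
  using assms by (simp add: distr_restrict_hist[symmetric] emeasure_distr vimage_def)

text \<open>The design chooses the arm from the past alone, so once arm \<open>a\<close> is chosen
  the new outcome has law \<open>P a\<close>, independently of the past.\<close>

lemma emeasure_next_outcome:
  assumes E: "E \<in> sets (hist_space t)" and B: "B \<in> sets borel"
  shows "emeasure Q {s. restrict s {0..<t} \<in> E \<and> fst (s t) = a \<and> snd (s t) \<in> B} =
    emeasure Q {s. restrict s {0..<t} \<in> E \<and> fst (s t) = a} * emeasure (P a) B"
proof -
  \<comment> \<open>The probability that the past lies in \<open>E\<close> and arm \<open>a\<close>
    is chosen next; it is identified as such below by putting the whole line for the outcome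
    set.\<close>
  define c where "c = (\<integral>\<^sup>+h. indicator E h * ennreal (pmf (\<pi> t h) a) \<partial>traj_law \<pi> P t)"
  have pm[measurable]: "(\<lambda>h. pmf (\<pi> t h) a) \<in> borel_measurable (hist_space t)" for a
    using design unfolding is_design_def by auto
  have st: "sets (traj_law \<pi> P t) = sets (hist_space t)"
    using traj_law_in_prob_algebra[OF design arm_distsD(1)[OF arms]] by (simp add: space_prob_algebra)
  have *: "emeasure Q {s. restrict s {0..<t} \<in> E \<and> fst (s t) = a \<and> snd (s t) \<in> B} = c * emeasure (P a) B"
    if B: "B \<in> sets borel" for B
  proof -
    define F where "F = {s \<in> space (hist_space (Suc t)). restrict s {0..<t} \<in> E \<and> fst (s t) = a \<and> snd (s t) \<in> B}"
    have r: "(\<lambda>s. restrict s {0..<t}) \<in> hist_space (Suc t) \<rightarrow>\<^sub>M hist_space t"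
      by (rule measurable_restrict_subset) auto
    have "(\<lambda>s. s t) \<in> hist_space (Suc t) \<rightarrow>\<^sub>M round_space" by simp
    note [measurable] = this r E B
    have F[measurable]: "F \<in> sets (hist_space (Suc t))" unfolding F_def by measurable
    have "emeasure Q {s. restrict s {0..<t} \<in> E \<and> fst (s t) = a \<and> snd (s t) \<in> B} =
        emeasure (traj_law \<pi> P (Suc t)) F"
      unfolding emeasure_traj_law[OF F]
      by (intro arg_cong[where f="emeasure Q"])
        (auto simp: F_def space_PiM space_pair_measure restrict_restrict Int_absorb1 min_absorb1)
    also have "\<dots> = (\<integral>\<^sup>+s. indicator F s \<partial>traj_law \<pi> P (Suc t))"
    proof -
      have "sets (traj_law \<pi> P (Suc t)) = sets (hist_space (Suc t))"
        using traj_law_in_prob_algebra[OF design arm_distsD(1)[OF arms]] by (simp add: space_prob_algebra)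
      then show ?thesis by simp
    qed
    also have "\<dots> = (\<integral>\<^sup>+h. (\<Sum>b\<in>UNIV. ennreal (pmf (\<pi> t h) b) * (\<integral>\<^sup>+x. indicator F (h(t := (b, x))) \<partial>P b)) \<partial>traj_law \<pi> P t)"
      by (rule nn_integral_traj_law_Suc[OF design arm_distsD(1)[OF arms]]) simp
    also have "\<dots> = (\<integral>\<^sup>+h. indicator E h * ennreal (pmf (\<pi> t h) a) * emeasure (P a) B \<partial>traj_law \<pi> P t)"
    proof (rule nn_integral_cong)
      fix h assume "h \<in> space (traj_law \<pi> P t)"
      then have h: "h \<in> space (hist_space t)" using st sets_eq_imp_space_eq by blast
      have hr: "restrict (h(t := z)) {0..<t} = h" for z
        using h by (auto simp: space_PiM PiE_def extensional_def restrict_def fun_eq_iff)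
      have hs: "h(t := z) \<in> space (hist_space (Suc t))" for z
        using h by (auto simp: space_PiM space_pair_measure PiE_def extensional_def)
      have "(\<Sum>b\<in>UNIV. ennreal (pmf (\<pi> t h) b) * (\<integral>\<^sup>+x. indicator F (h(t := (b, x))) \<partial>P b)) =
         (\<Sum>b\<in>UNIV. if b = a then ennreal (pmf (\<pi> t h) a) * (indicator E h * emeasure (P a) B) else 0)"
      proof (rule sum.cong[OF refl])
        fix b
        have "(\<integral>\<^sup>+x. indicator F (h(t := (b, x))) \<partial>P b) = (\<integral>\<^sup>+x. (if b = a then indicator E h else 0) * indicator B x \<partial>P b)"
          by (rule nn_integral_cong) (auto simp: F_def hr hs split: split_indicator)
        also have "\<dots> = (if b = a then indicator E h * emeasure (P a) B else 0)"
          using B by (subst nn_integral_cmult_indicator) (auto simp: arm_distsD(2)[OF arms])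
        finally show "ennreal (pmf (\<pi> t h) b) * (\<integral>\<^sup>+x. indicator F (h(t := (b, x))) \<partial>P b) =
           (if b = a then ennreal (pmf (\<pi> t h) a) * (indicator E h * emeasure (P a) B) else 0)"
          by simp
      qed
      then show "(\<Sum>b\<in>UNIV. ennreal (pmf (\<pi> t h) b) * (\<integral>\<^sup>+x. indicator F (h(t := (b, x))) \<partial>P b)) =
         indicator E h * ennreal (pmf (\<pi> t h) a) * emeasure (P a) B"
        by (simp add: mult_ac)
    qed
    also have "\<dots> = c * emeasure (P a) B"
      unfolding c_def using E pm
      by (intro nn_integral_multc) (auto simp: measurable_cong_sets[OF st refl])
    finally show ?thesis .
  qed
  have "emeasure (P a) UNIV = 1"
    using prob_space.emeasure_space_1[OF arm_distsD(3)[OF arms]] sets_eq_imp_space_eq[OF arm_distsD(2)[OF arms]]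
    by simp
  then have "emeasure Q {s. restrict s {0..<t} \<in> E \<and> fst (s t) = a} = c"
    using *[of UNIV] by simp
  with *[OF B] show ?thesis by simp
qed

text \<open>Almost surely exactly one round contains the pull of \<open>a\<close> that is preceded by \<open>N\<close> pulls.\<close>

lemma emeasure_split_pull:
  assumes G: "G \<in> sets Q"
  shows "emeasure Q G = (\<Sum>t. emeasure Q {s \<in> G. fst (s t) = a \<and> pulls a t s = N})"
proof -
  let ?F = "\<lambda>t. {s \<in> G. fst (s t) = a \<and> pulls a t s = N}"
  have m[measurable]: "pulls a t \<in> Q \<rightarrow>\<^sub>M count_space UNIV" for t
    by (simp add: measurable_cong_sets[OF sets_Q refl] measurable_pulls)
  have F: "?F t \<in> sets Q" for t
  proof -
    have "Measurable.pred Q (\<lambda>s. fst (s t) = a \<and> pulls a t s = N)" by measurable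
    then have "{s \<in> space Q. fst (s t) = a \<and> pulls a t s = N} \<inter> G \<in> sets Q" using G by auto
    then show ?thesis by (simp add: Int_def conj_ac)
  qed
  have "emeasure Q G = emeasure Q (\<Union>t. ?F t)"
  proof (rule emeasure_eq_AE)
    show "AE s in Q. s \<in> G \<longleftrightarrow> s \<in> (\<Union>t. ?F t)"
      using pulls_at_top[of a]
    proof eventually_elim
      case (elim s)
      then obtain t where "N < pulls a t s"
        unfolding filterlim_at_top eventually_sequentially by (meson Suc_le_lessD order_refl)
      from ex_pull[OF this] show ?case by auto
    qed
  qed (use G F in auto)
  also have "\<dots> = (\<Sum>t. emeasure Q (?F t))"
  proof (rule suminf_emeasure[symmetric])
    show "disjoint_family ?F"
      unfolding disjoint_family_on_def
    proof (intro ballI impI equals0I)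
      fix t t' s assume "t \<noteq> t'" "s \<in> ?F t \<inter> ?F t'"
      then show False using pulls_less[of s t a t'] pulls_less[of s t' a t] by (cases "t < t'") auto
    qed
  qed (use F in auto)
  finally show ?thesis .
qed

text \<open>The round t that yields the reward of index \<open>N\<close> is random, so the event is
  split according to t. For fixed t the earlier rewards are functions of the past and the new
  outcome contributes the factor \<open>emeasure (P a) (B N)\<close>, the same for every t.\<close>

lemma emeasure_rewards:
  assumes B: "\<And>n. B n \<in> sets borel"
  shows "emeasure Q {s. \<forall>n<N. reward a n s \<in> B n} = (\<Prod>n<N. emeasure (P a) (B n))"
proof (induction N)
  case 0
  then show ?case using emeasure_space_1 by simp
next
  case (Suc N)
  note [measurable] = B
  have rm[measurable]: "reward a n \<in> borel_measurable Q" for n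
    by (simp add: measurable_cong_sets[OF sets_Q refl])
  \<comment> \<open>\<open>reward\<close> reads the whole sequence through \<open>pull_time\<close>.
    Before the pull of index \<open>N\<close> the condition on the first \<open>N\<close> rewards is
    rewritten in terms of the first t rounds, as \<open>emeasure_next_outcome\<close>
    requires.\<close>
  define E where "E t = {h \<in> space (hist_space t). pulls a t h = N \<and>
     (\<forall>i\<in>{..<t}. \<forall>n. fst (h i) = a \<and> pulls a i h = n \<longrightarrow> snd (h i) \<in> B n)}" for t
  have E: "E t \<in> sets (hist_space t)" for t
  proof -
    have [measurable]: "pulls a i \<in> hist_space t \<rightarrow>\<^sub>M count_space UNIV" if "i \<le> t" for i
      using that by (intro measurable_pulls) auto
    have "Measurable.pred (hist_space t) (\<lambda>h. \<forall>n. fst (h i) = a \<and> pulls a i h = n \<longrightarrow> snd (h i) \<in> B n)" if "i < t" for i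
    proof -
      have [measurable]: "(\<lambda>h. h i) \<in> hist_space t \<rightarrow>\<^sub>M round_space" "pulls a i \<in> hist_space t \<rightarrow>\<^sub>M count_space UNIV"
        using that by (auto intro!: measurable_pulls)
      show ?thesis by measurable
    qed
    then have [measurable]: "Measurable.pred (hist_space t) (\<lambda>h. \<forall>i\<in>{..<t}. \<forall>n. fst (h i) = a \<and> pulls a i h = n \<longrightarrow> snd (h i) \<in> B n)"
      by (intro pred_intros_finite) auto
    have [measurable]: "pulls a t \<in> hist_space t \<rightarrow>\<^sub>M count_space UNIV"
      by (intro measurable_pulls) auto
    show ?thesis unfolding E_def by measurable
  qed
  have E_iff: "restrict s {0..<t} \<in> E t \<longleftrightarrow> pulls a t s = N \<and> (\<forall>n<N. reward a n s \<in> B n)" for s t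
  proof -
    have "restrict s {0..<t} \<in> E t \<longleftrightarrow> pulls a t s = N \<and> (\<forall>i<t. fst (s i) = a \<longrightarrow> snd (s i) \<in> B (pulls a i s))"
      using pulls_cong[of _ s "restrict s {0..<t}" a] by (auto simp: E_def space_PiM space_pair_measure)
    also have "\<dots> \<longleftrightarrow> pulls a t s = N \<and> (\<forall>n<N. reward a n s \<in> B n)"
    proof (intro conj_cong refl iffI allI impI)
      fix n assume "pulls a t s = N" "n < N" and *: "\<forall>i<t. fst (s i) = a \<longrightarrow> snd (s i) \<in> B (pulls a i s)"
      then obtain i where "i < t" "fst (s i) = a" "pulls a i s = n" using ex_pull[of n a t s] by auto
      with * show "reward a n s \<in> B n" using reward_pulls[of s i a] by auto
    next
      fix i assume "pulls a t s = N" "i < t" "fst (s i) = a" and *: "\<forall>n<N. reward a n s \<in> B n"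
      then show "snd (s i) \<in> B (pulls a i s)" using pulls_less[of s i a t] reward_pulls[of s i a] by auto
    qed
    finally show ?thesis .
  qed
  have "emeasure Q {s. \<forall>n<Suc N. reward a n s \<in> B n} =
     (\<Sum>t. emeasure Q {s \<in> {s. \<forall>n<Suc N. reward a n s \<in> B n}. fst (s t) = a \<and> pulls a t s = N})"
  proof (rule emeasure_split_pull)
    have "{s \<in> space Q. \<forall>n\<in>{..<Suc N}. reward a n s \<in> B n} \<in> sets Q" by measurable
    then show "{s. \<forall>n<Suc N. reward a n s \<in> B n} \<in> sets Q" by (simp add: Ball_def)
  qed
  also have "\<dots> = (\<Sum>t. emeasure Q {s. restrict s {0..<t} \<in> E t \<and> fst (s t) = a \<and> snd (s t) \<in> B N})"
    by (intro suminf_cong arg_cong[where f="emeasure Q"])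
      (auto simp: E_iff less_Suc_eq reward_pulls)
  also have "\<dots> = (\<Sum>t. emeasure Q {s. restrict s {0..<t} \<in> E t \<and> fst (s t) = a} * emeasure (P a) (B N))"
    by (intro suminf_cong emeasure_next_outcome E B)
  also have "\<dots> = (\<Sum>t. emeasure Q {s. restrict s {0..<t} \<in> E t \<and> fst (s t) = a}) * emeasure (P a) (B N)"
    by simp
  \<comment> \<open>The splitting is now undone, for the event about \<open>N\<close> rewards
    only.\<close>
  also have "(\<Sum>t. emeasure Q {s. restrict s {0..<t} \<in> E t \<and> fst (s t) = a}) =
     (\<Sum>t. emeasure Q {s \<in> {s. \<forall>n<N. reward a n s \<in> B n}. fst (s t) = a \<and> pulls a t s = N})"
    by (intro suminf_cong arg_cong[where f="emeasure Q"]) (auto simp: E_iff)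
  also have "\<dots> = emeasure Q {s. \<forall>n<N. reward a n s \<in> B n}"
  proof (rule emeasure_split_pull[symmetric])
    have "{s \<in> space Q. \<forall>n\<in>{..<N}. reward a n s \<in> B n} \<in> sets Q" by measurable
    then show "{s. \<forall>n<N. reward a n s \<in> B n} \<in> sets Q" by (simp add: Ball_def)
  qed
  finally show ?case by (simp add: Suc.IH)
qed

lemma measurable_rewards:
  "(\<lambda>s n. reward a n s) \<in> Q \<rightarrow>\<^sub>M PiM UNIV (\<lambda>_. P a)"
proof -
  have rm: "reward a n \<in> Q \<rightarrow>\<^sub>M P a" for n
    by (simp add: measurable_cong_sets[OF sets_Q arm_distsD(2)[OF arms]])
  have "space (P a) = UNIV" using sets_eq_imp_space_eq[OF arm_distsD(2)[OF arms]] by simp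
  with rm show ?thesis
    by (intro measurable_PiM_single') (auto simp: space_PiM)
qed

lemma distr_rewards:
  "distr Q (PiM UNIV (\<lambda>_. P a)) (\<lambda>s n. reward a n s) = PiM UNIV (\<lambda>_. P a)"
proof -
  interpret Pa: prob_space "P a" by (rule arm_distsD(3)[OF arms])
  interpret PP: product_prob_space "\<lambda>_. P a" "UNIV :: nat set" ..
  have sp: "space (P a) = UNIV" using sets_eq_imp_space_eq[OF arm_distsD(2)[OF arms]] by simp
  show ?thesis
  proof (rule PP.PiM_eq)
    fix J :: "nat set" and F assume J: "finite J" "J \<subseteq> UNIV" and F: "\<And>j. j \<in> J \<Longrightarrow> F j \<in> sets (P a)"
    \<comment> \<open>Padding with the whole line turns the finite index set J into an initial
      segment, the form treated by \<open>emeasure_rewards\<close>.\<close>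
    define B where "B n = (if n \<in> J then F n else UNIV)" for n
    obtain N where N: "J \<subseteq> {..<N}" using J finite_nat_iff_bounded by blast
    have "emeasure (distr Q (PiM UNIV (\<lambda>_. P a)) (\<lambda>s n. reward a n s)) (prod_emb UNIV (\<lambda>_. P a) J (Pi\<^sub>E J F)) =
       emeasure Q ((\<lambda>s n. reward a n s) -` prod_emb UNIV (\<lambda>_. P a) J (Pi\<^sub>E J F) \<inter> space Q)"
      by (rule emeasure_distr[OF measurable_rewards]) (use J F in \<open>auto intro!: sets_PiM_I\<close>)
    also have "(\<lambda>s n. reward a n s) -` prod_emb UNIV (\<lambda>_. P a) J (Pi\<^sub>E J F) \<inter> space Q =
       {s. \<forall>n<N. reward a n s \<in> B n}"
      using N by (auto simp: prod_emb_def B_def space_PiM sp PiE_iff restrict_def extensional_def subset_eq)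
    also have "emeasure Q \<dots> = (\<Prod>n<N. emeasure (P a) (B n))"
      by (rule emeasure_rewards) (use F in \<open>auto simp: B_def arm_distsD(2)[OF arms]\<close>)
    also have "\<dots> = (\<Prod>n\<in>J. emeasure (P a) (B n))"
      using N Pa.emeasure_space_1 by (intro prod.mono_neutral_right) (auto simp: B_def sp)
    also have "\<dots> = (\<Prod>n\<in>J. emeasure (P a) (F n))"
      by (intro prod.cong) (auto simp: B_def)
    finally show "emeasure (distr Q (PiM UNIV (\<lambda>_. P a)) (\<lambda>s n. reward a n s)) (prod_emb UNIV (\<lambda>_. P a) J (Pi\<^sub>E J F)) =
       (\<Prod>n\<in>J. emeasure (P a) (F n))" .
  qed simp
qed

lemma AE_rewards:
  assumes "AE y in PiM UNIV (\<lambda>_. P a). R y"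
  shows "AE s in Q. R (\<lambda>n. reward a n s)"
  by (rule AE_distrD[OF measurable_rewards]) (use assms in \<open>simp only: distr_rewards\<close>)

text \<open>The strong law holds for the reward sequence with a deterministic index; since the pull
  count diverges along almost every path, it may be substituted for the index pathwise, whatever its
  dependence on the rewards.\<close>

lemma AE_average_pulled:
  fixes g :: "real \<Rightarrow> real"
  assumes g: "integrable (P a) g"
  shows "AE s in Q. (\<lambda>T. (\<Sum>t | t \<in> {0..<T} \<and> fst (s t) = a. g (snd (s t))) / real (pulls a T s))
     \<longlonglongrightarrow> (\<integral>x. g x \<partial>P a)"
  using pulls_at_top[of a] AE_rewards[OF strong_law_of_large_numbers[OF arm_distsD(3)[OF arms] g]]
proof eventually_elim
  case (elim s)
  from filterlim_compose[OF elim(2,1)] show ?case by (simp only: sum_pulled)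
qed

end

section \<open>Normal arms and estimated moments\<close>

lemma distr_PiM_nat_map:
  assumes D: "prob_space D" and f: "f \<in> D \<rightarrow>\<^sub>M N"
  shows "distr (PiM UNIV (\<lambda>_::nat. D)) (PiM UNIV (\<lambda>_. N)) (\<lambda>s i. f (s i)) = PiM UNIV (\<lambda>_. distr D N f)"
proof -
  let ?M = "PiM UNIV (\<lambda>_::nat. D)"
  interpret M: prob_space ?M by (intro prob_space_PiM D)
  note [measurable] = f
  have "distr ?M N (\<lambda>s. f (s i)) = distr D N f" for i
    using distr_distr[of f D N "\<lambda>s. s i" ?M] by (simp add: distr_PiM_nat_component[OF D] comp_def)
  moreover have "M.indep_vars (\<lambda>_. N) (\<lambda>i s. f (s i)) UNIV"
    by (rule M.indep_vars_compose2[OF indep_vars_PiM_nat[OF D]]) (rule f)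
  ultimately show ?thesis
    by (subst (asm) M.indep_vars_iff_distr_eq_PiM) (auto simp: restrict_def)
qed

lemma prob_space_std_normal: "prob_space std_normal_distribution"
  using real_dist_normal_dist by (simp add: real_distribution_def)

text \<open>The location-scale form treats the point mass at \<open>v = 0\<close> together with the
  densities. It yields measurability in the parameters and lets a single standard normal sequence
  represent all variances.\<close>

lemma normal_law_eq_distr:
  assumes "0 \<le> v"
  shows "normal_law m v = distr std_normal_distribution borel (\<lambda>z. m + sqrt v * z)"
proof (cases "v = 0")
  case True
  then show ?thesis
    using prob_space.distr_const[OF prob_space_std_normal, of m borel] by (simp add: normal_law_def)
next
  case False
  interpret prob_space std_normal_distribution by (rule prob_space_std_normal)
  have "distributed std_normal_distribution lborel (\<lambda>x. x) (normal_density 0 1)"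
    unfolding distributed_def by (auto simp: distr_id2)
  from normal_density_affine[OF this, of "sqrt v" m] assms False
  show ?thesis
    by (auto simp: distributed_def normal_law_def cong: distr_cong)
qed

lemma prob_space_normal_law: "0 \<le> v \<Longrightarrow> prob_space (normal_law m v)"
  by (simp add: normal_law_eq_distr prob_space.prob_space_distr[OF prob_space_std_normal])

lemma sets_normal_law [simp]: "sets (normal_law m v) = sets borel"
  by (simp add: normal_law_def)

lemma integrable_normal_law: "0 \<le> v \<Longrightarrow> integrable (normal_law m v) (\<lambda>x. x)"
proof -
  assume v: "0 \<le> v"
  interpret prob_space std_normal_distribution by (rule prob_space_std_normal)
  have "integrable std_normal_distribution (\<lambda>z. m + sqrt v * z)"
    using integrable_std_normal_distribution_moment[of 1] by simp
  then show ?thesis using v by (subst normal_law_eq_distr) (auto simp: integrable_distr_eq)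
qed

lemma arm_dists_normal_law: "(\<And>a. 0 \<le> v a) \<Longrightarrow> arm_dists (\<lambda>a. normal_law (m a) (v a))"
  by (simp add: arm_dists_def prob_space_normal_law integrable_normal_law)

lemma measurable_normal_law:
  assumes [measurable]: "m \<in> borel_measurable N" "v \<in> borel_measurable N" and v: "\<And>x. x \<in> space N \<Longrightarrow> 0 \<le> v x"
  shows "(\<lambda>x. normal_law (m x) (v x)) \<in> N \<rightarrow>\<^sub>M prob_algebra borel"
proof -
  have "(\<lambda>x. distr std_normal_distribution borel (\<lambda>z. m x + sqrt (v x) * z)) \<in> N \<rightarrow>\<^sub>M prob_algebra borel"
  proof (rule measurable_distr_prob_space2)
    show "(\<lambda>_. std_normal_distribution) \<in> N \<rightarrow>\<^sub>M prob_algebra borel"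
      by (rule measurable_const) (simp add: space_prob_algebra prob_space_std_normal)
  qed measurable
  then show ?thesis
    by (rule measurable_cong[THEN iffD1, rotated]) (simp add: normal_law_eq_distr v)
qed

text \<open>By Scheffe's lemma pointwise convergence of the densities gives convergence in L1, and
  the L1 distance bounds the error for all test functions at once. A point mass as limit has no
  density, so there the parameters must eventually be exact.\<close>

lemma normal_law_perturb:
  fixes m :: "nat \<Rightarrow> real"
  assumes m: "m \<longlonglongrightarrow> m'" and v: "v \<longlonglongrightarrow> v'" and v0: "\<And>n. 0 \<le> v n" and v'0: "0 \<le> v'"
    and dg: "v' = 0 \<Longrightarrow> \<forall>\<^sub>F n in sequentially. m n = m' \<and> v n = 0"
  shows "\<exists>c. c \<longlonglongrightarrow> (0::ennreal) \<and> (\<forall>n g. g \<in> borel_measurable borel \<longrightarrow> (\<forall>x. g x \<le> 1) \<longrightarrow>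
    (\<integral>\<^sup>+x. g x \<partial>normal_law (m n) (v n)) \<le> (\<integral>\<^sup>+x. g x \<partial>normal_law m' v') + c n)"
proof -
  have le1: "(\<integral>\<^sup>+x. g x \<partial>normal_law (m n) (v n)) \<le> 1" if "\<forall>x. g x \<le> 1" for g n
  proof -
    interpret prob_space "normal_law (m n) (v n)" by (rule prob_space_normal_law[OF v0])
    have "(\<integral>\<^sup>+x. g x \<partial>normal_law (m n) (v n)) \<le> (\<integral>\<^sup>+x. 1 \<partial>normal_law (m n) (v n))"
      using that by (intro nn_integral_mono) auto
    then show ?thesis by (simp add: emeasure_space_1)
  qed
  show ?thesis
  proof (cases "v' = 0")
    case True
    define c where "c n = (if m n = m' \<and> v n = 0 then 0 else 1 :: ennreal)" for n
    have "c \<longlonglongrightarrow> 0"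
      by (rule tendsto_eventually) (use dg[OF True] in \<open>auto elim!: eventually_mono simp: c_def\<close>)
    moreover have "(\<integral>\<^sup>+x. g x \<partial>normal_law (m n) (v n)) \<le> (\<integral>\<^sup>+x. g x \<partial>normal_law m' v') + c n" if "\<forall>x. g x \<le> 1" for g n
      using le1[OF that, of n] True by (auto simp: c_def intro: order_trans)
    ultimately show ?thesis by blast
  next
    case False
    then have vp: "0 < v'" using v'0 by simp
    define f where "f = normal_density m' (sqrt v')"
    \<comment> \<open>With a positive limit only finitely many \<open>v n\<close> vanish. For those
      n the limit density is a harmless substitute in \<open>F\<close>, and the trivial bound 1 is
      used in \<open>c\<close>.\<close>
    define F where "F n = (if v n = 0 then f else normal_density (m n) (sqrt (v n)))" for n
    define c where "c n = (if v n = 0 then 1 else \<integral>\<^sup>+x. norm (F n x - f x) \<partial>lborel)" for n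
    have ev: "\<forall>\<^sub>F n in sequentially. 0 < v n" by (rule order_tendstoD(1)[OF v vp])
    have [measurable]: "F n \<in> borel_measurable lborel" "f \<in> borel_measurable lborel" for n
      by (auto simp: F_def f_def)
    have nd: "(\<integral>\<^sup>+x. ennreal (norm (normal_density a (sqrt b) x)) \<partial>lborel) = 1" if "0 < b" for a b
    proof -
      interpret prob_space "density lborel (normal_density a (sqrt b))"
        by (rule prob_space_normal_density) (use that in simp)
      show ?thesis using emeasure_space_1 that by (simp add: emeasure_density)
    qed
    have "(\<lambda>n. \<integral>\<^sup>+x. norm (F n x - f x) \<partial>lborel) \<longlonglongrightarrow> 0"
    proof (rule Scheffe_lemma2)
      show "integrable lborel f" using vp by (simp add: f_def)
      show "AE x in lborel. (\<lambda>n. F n x) \<longlonglongrightarrow> f x"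
      proof (rule AE_I2)
        fix x
        have "(\<lambda>n. normal_density (m n) (sqrt (v n)) x) \<longlonglongrightarrow> f x"
          unfolding f_def normal_density_def
          by (intro tendsto_intros m v) (use vp in auto)
        then show "(\<lambda>n. F n x) \<longlonglongrightarrow> f x"
          by (rule Lim_transform_eventually)
            (use ev in \<open>auto elim!: eventually_mono simp: F_def\<close>)
      qed
      show "(\<integral>\<^sup>+x. norm (F n x) \<partial>lborel) \<le> (\<integral>\<^sup>+x. norm (f x) \<partial>lborel)" for n
        using nd[of "v n" "m n"] nd[of v' m'] vp v0[of n] by (auto simp: F_def f_def less_le)
    qed measurable
    then have "c \<longlonglongrightarrow> 0"
      by (rule Lim_transform_eventually) (use ev in \<open>auto elim!: eventually_mono simp: c_def\<close>)
    moreover have "(\<integral>\<^sup>+x. g x \<partial>normal_law (m n) (v n)) \<le> (\<integral>\<^sup>+x. g x \<partial>normal_law m' v') + c n"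
      if g[measurable]: "g \<in> borel_measurable borel" and "\<forall>x. g x \<le> 1" for g n
    proof (cases "v n = 0")
      case True
      then show ?thesis using le1[OF that(2), of n] by (auto simp: c_def intro: order_trans)
    next
      case nz: False
      have "(\<integral>\<^sup>+x. g x \<partial>normal_law (m n) (v n)) = (\<integral>\<^sup>+x. ennreal (F n x) * g x \<partial>lborel)"
        using nz by (simp add: normal_law_def F_def nn_integral_density)
      also have "\<dots> \<le> (\<integral>\<^sup>+x. ennreal (f x) * g x + ennreal (norm (F n x - f x)) \<partial>lborel)"
      proof (rule nn_integral_mono)
        fix x
        have "ennreal (F n x) \<le> ennreal (f x + norm (F n x - f x))"
          by (rule ennreal_leI) auto
        also have "\<dots> = ennreal (f x) + ennreal (norm (F n x - f x))"
          by (rule ennreal_plus) (auto simp: f_def)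
        finally have "ennreal (F n x) \<le> ennreal (f x) + ennreal (norm (F n x - f x))" .
        then have "ennreal (F n x) * g x \<le> (ennreal (f x) + ennreal (norm (F n x - f x))) * g x"
          by (rule mult_right_mono) simp
        also have "\<dots> \<le> ennreal (f x) * g x + ennreal (norm (F n x - f x)) * 1"
          unfolding distrib_right using that by (intro add_left_mono mult_left_mono) auto
        finally show "ennreal (F n x) * g x \<le> ennreal (f x) * g x + ennreal (norm (F n x - f x))" by simp
      qed
      also have "\<dots> = (\<integral>\<^sup>+x. g x \<partial>normal_law m' v') + c n"
        using nz False by (subst nn_integral_add) (auto simp: normal_law_def f_def c_def nn_integral_density)
      finally show ?thesis .
    qed
    ultimately show ?thesis by blast
  qed
qed

section \<open>Measurability and consistency of sample mean and sample variance\<close>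

lemma measurable_arm_mean [measurable]:
  assumes "{0..<T} \<subseteq> J"
  shows "arm_mean a T \<in> borel_measurable (PiM J (\<lambda>_. round_space))"
proof -
  have [measurable]: "pulls a T \<in> PiM J (\<lambda>_. round_space) \<rightarrow>\<^sub>M count_space UNIV"
    using assms by (rule measurable_pulls)
  have eq: "arm_mean a T = (\<lambda>h. (\<Sum>t\<in>{0..<T}. if fst (h t) = a then snd (h t) else 0) / real (pulls a T h))"
    unfolding arm_mean_def[abs_def] by (subst sum.inter_filter[symmetric]) auto
  have "(\<lambda>h. if fst (h t) = a then snd (h t) else 0) \<in> borel_measurable (PiM J (\<lambda>_. round_space))" if "t \<in> {0..<T}" for t
  proof -
    have [measurable]: "(\<lambda>h. h t) \<in> PiM J (\<lambda>_. round_space) \<rightarrow>\<^sub>M round_space" using that assms by auto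
    show ?thesis by measurable
  qed
  then show ?thesis
    unfolding eq by (intro borel_measurable_divide borel_measurable_sum) (auto intro: measurable_compose)
qed

lemma measurable_arm_var [measurable]:
  assumes "{0..<T} \<subseteq> J"
  shows "arm_var d a T \<in> borel_measurable (PiM J (\<lambda>_. round_space))"
proof -
  have [measurable]: "pulls a T \<in> PiM J (\<lambda>_. round_space) \<rightarrow>\<^sub>M count_space UNIV"
    using assms by (rule measurable_pulls)
  note [measurable] = measurable_arm_mean[OF assms]
  have eq: "arm_var d a T = (\<lambda>h. (\<Sum>t\<in>{0..<T}. if fst (h t) = a then (snd (h t) - arm_mean a T h)\<^sup>2 else 0) / (real (pulls a T h) - real d))"
    unfolding arm_var_def[abs_def] by (subst sum.inter_filter[symmetric]) auto
  have "(\<lambda>h. if fst (h t) = a then (snd (h t) - arm_mean a T h)\<^sup>2 else 0) \<in> borel_measurable (PiM J (\<lambda>_. round_space))" if "t \<in> {0..<T}" for t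
  proof -
    have [measurable]: "(\<lambda>h. h t) \<in> PiM J (\<lambda>_. round_space) \<rightarrow>\<^sub>M round_space" using that assms by auto
    show ?thesis by measurable
  qed
  then show ?thesis
    unfolding eq by (intro borel_measurable_divide borel_measurable_sum) (auto intro: measurable_compose)
qed

text \<open>For \<open>d = 1\<close> without pulls the divisor is \<open>-1\<close>, but the sum is empty.\<close>

lemma arm_var_nonneg: "d \<le> 1 \<Longrightarrow> 0 \<le> arm_var d a T h"
proof (cases "pulls a T h = 0")
  case True
  then have "{t. t \<in> {0..<T} \<and> fst (h t) = a} = {}" by (auto simp: pulls_def card_eq_0_iff)
  then show ?thesis by (simp only: arm_var_def sum.empty)
qed (auto simp: arm_var_def intro!: divide_nonneg_nonneg sum_nonneg)

lemma arm_mean_cong: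
  assumes "\<And>i. i < T \<Longrightarrow> s i = s' i" shows "arm_mean a T s = arm_mean a T s'"
  unfolding arm_mean_def using assms pulls_cong[of T s s' a] by (auto intro!: sum.cong arg_cong2[where f="(/)"])

lemma arm_var_cong:
  assumes "\<And>i. i < T \<Longrightarrow> s i = s' i" shows "arm_var d a T s = arm_var d a T s'"
  unfolding arm_var_def using assms pulls_cong[of T s s' a] arm_mean_cong[of T s s' a]
  by (auto intro!: sum.cong arg_cong2[where f="(/)"])

context canonical_experiment
begin

lemma AE_arm_mean: "AE s in Q. (\<lambda>T. arm_mean a T s) \<longlonglongrightarrow> mean (P a)"
  using AE_average_pulled[OF arm_distsD(4)[OF arms]] by (simp add: arm_mean_def mean_def)

text \<open>Centring at the true mean makes the summands i.i.d.; the price is the square of the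
  error of the sample mean, which vanishes. The divisor contributes a factor 1 / (1 - d/N) that
  tends to 1.\<close>

lemma AE_arm_var:
  assumes fv: "finite_variance (P a)"
  shows "AE s in Q. (\<lambda>T. arm_var d a T s) \<longlonglongrightarrow> (\<integral>x. (x - mean (P a))\<^sup>2 \<partial>P a)"
  using AE_average_pulled[OF fv[unfolded finite_variance_def]] AE_arm_mean[of a] pulls_at_top[of a]
proof eventually_elim
  case (elim s)
  let ?S = "\<lambda>T. {t. t \<in> {0..<T} \<and> fst (s t) = a}" and ?N = "\<lambda>T. real (pulls a T s)"
  define G where "G T = (\<Sum>t\<in>?S T. (snd (s t) - mean (P a))\<^sup>2)" for T
  have N: "filterlim ?N at_top sequentially"
    by (rule filterlim_compose[OF filterlim_real_sequentially elim(3)])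
  have "(\<lambda>T. (G T / ?N T - (arm_mean a T s - mean (P a))\<^sup>2) * (1 / (1 - real d / ?N T)))
     \<longlonglongrightarrow> ((\<integral>x. (x - mean (P a))\<^sup>2 \<partial>P a) - (mean (P a) - mean (P a))\<^sup>2) * (1 / (1 - 0))"
    using elim(1) unfolding G_def[symmetric]
    by (intro tendsto_intros elim(2) tendsto_divide_0[OF tendsto_const] filterlim_at_top_imp_at_infinity N) auto
  then have *: "(\<lambda>T. (G T / ?N T - (arm_mean a T s - mean (P a))\<^sup>2) * (1 / (1 - real d / ?N T)))
     \<longlonglongrightarrow> (\<integral>x. (x - mean (P a))\<^sup>2 \<partial>P a)" by simp
  show ?case
  proof (rule Lim_transform_eventually[OF *])
    have "\<forall>\<^sub>F T in sequentially. 0 < ?N T \<and> real d < ?N T"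
      using N by (intro eventually_conj) (auto simp: filterlim_at_top_dense simp del: of_nat_less_iff of_nat_0_less_iff)
    then show "\<forall>\<^sub>F T in sequentially. (G T / ?N T - (arm_mean a T s - mean (P a))\<^sup>2) * (1 / (1 - real d / ?N T)) = arm_var d a T s"
    proof eventually_elim
      case (elim T)
      let ?m = "arm_mean a T s" and ?\<mu> = "mean (P a)"
      have c: "card (?S T) = pulls a T s" by (simp add: pulls_def)
      have sm: "(\<Sum>t\<in>?S T. snd (s t)) = ?N T * ?m" using elim by (simp add: arm_mean_def)
      \<comment> \<open>The difference of the two squares is affine in the outcome, so its sum
        involves only the sample mean and the pull count.\<close>
      have "(\<Sum>t\<in>?S T. (snd (s t) - ?m)\<^sup>2) =
        (\<Sum>t\<in>?S T. (snd (s t) - ?\<mu>)\<^sup>2 + 2 * (?\<mu> - ?m) * snd (s t) + (?m\<^sup>2 - ?\<mu>\<^sup>2))"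
        by (intro sum.cong refl) (simp add: power2_eq_square algebra_simps)
      also have "\<dots> = G T + 2 * (?\<mu> - ?m) * (?N T * ?m) + ?N T * (?m\<^sup>2 - ?\<mu>\<^sup>2)"
        unfolding sum.distrib sum_distrib_left[symmetric] sm G_def sum_constant c by simp
      also have "\<dots> = G T - ?N T * (?m - ?\<mu>)\<^sup>2"
        by (simp add: power2_eq_square algebra_simps)
      finally have "arm_var d a T s = (G T - ?N T * (?m - ?\<mu>)\<^sup>2) / (?N T - real d)"
        by (simp add: arm_var_def)
      also have "\<dots> = (G T / ?N T - (?m - ?\<mu>)\<^sup>2) * (1 / (1 - real d / ?N T))"
        using elim by (simp add: field_simps)
      finally show ?case ..
    qed
  qed
qed

text \<open>With zero variance every reward equals the mean almost surely, so one pull already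
  determines both estimates. This supplies the exactness that the point-mass case of
  \<open>normal_law_perturb\<close> demands.\<close>

lemma AE_degenerate_arm:
  assumes fv: "finite_variance (P a)" and z: "(\<integral>x. (x - mean (P a))\<^sup>2 \<partial>P a) = 0"
  shows "AE s in Q. \<forall>\<^sub>F T in sequentially. arm_mean a T s = mean (P a) \<and> arm_var d a T s = 0"
proof -
  have "AE x in P a. (x - mean (P a))\<^sup>2 = 0"
    using z fv by (subst (asm) integral_nonneg_eq_0_iff_AE) (auto simp: finite_variance_def)
  then have "AE x in P a. x = mean (P a)" by simp
  then have "AE y in PiM UNIV (\<lambda>_::nat. P a). y n = mean (P a)" for n
    by (intro AE_PiM_component[where P="\<lambda>x. x = mean (P a)"]) (auto intro: arm_distsD(3)[OF arms])
  then have "AE y in PiM UNIV (\<lambda>_::nat. P a). \<forall>n. y n = mean (P a)" by (simp add: AE_all_countable)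
  from AE_rewards[OF this] pulls_at_top[of a] show ?thesis
  proof eventually_elim
    case (elim s)
    have "\<forall>\<^sub>F T in sequentially. 1 \<le> pulls a T s" using elim(2) by (simp add: filterlim_at_top)
    then show ?case
    proof eventually_elim
      case (elim T)
      have m: "arm_mean a T s = mean (P a)"
        using elim \<open>\<forall>n. reward a n s = mean (P a)\<close> sum_pulled[of "\<lambda>x. x" s T a]
        by (simp only: arm_mean_def) simp
      \<comment> \<open>The numerator is 0, so the quotient is 0 even when the divisor is 0, as
        after a single pull with \<open>d = 1\<close>.\<close>
      moreover have "arm_var d a T s = 0"
        using \<open>\<forall>n. reward a n s = mean (P a)\<close> sum_pulled[of "\<lambda>x. (x - mean (P a))\<^sup>2" s T a]
        by (simp only: arm_var_def m) simp
      ultimately show ?case ..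
    qed
  qed
qed

end

section \<open>Concentration of the simulated mean\<close>

lemma pulls_restrict: "pulls a t (restrict s {0..<t}) = pulls a t s"
  by (rule pulls_cong) simp

lemma arm_mean_restrict: "arm_mean a t (restrict s {0..<t}) = arm_mean a t s"
  by (rule arm_mean_cong) simp

lemma arm_var_restrict: "arm_var d a t (restrict s {0..<t}) = arm_var d a t s"
  by (rule arm_var_cong) simp

text \<open>All the normal sequences are images of one standard normal sequence, and scaling by at
  most \<open>C\<close> keeps the deviation under control, so one index m serves all v. The tail
  covers every n from m on because the pull count is random.\<close>

lemma normal_average_tail:
  assumes \<delta>: "0 < \<delta>" and \<epsilon>: "0 < \<epsilon>"
  shows "\<exists>m\<ge>1. \<forall>v. 0 \<le> v \<longrightarrow> sqrt v \<le> C \<longrightarrow>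
    emeasure (PiM UNIV (\<lambda>_::nat. normal_law \<theta> v)) {y. \<exists>n\<ge>m. \<delta> < \<bar>(\<Sum>i<n. y i) / real n - \<theta>\<bar>} < ennreal \<epsilon>"
proof -
  let ?N = "PiM UNIV (\<lambda>_::nat. std_normal_distribution)"
  note std = prob_space_std_normal
  interpret N: prob_space ?N by (intro prob_space_PiM std)
  \<comment> \<open>These events decrease in m, and by the strong law their intersection is null;
    continuity from above makes their probabilities small.\<close>
  define D where "D m = {z. \<exists>n\<ge>m. \<delta> < C * \<bar>(\<Sum>i<n. z i) / real n\<bar>}" for m :: nat
  have spN: "space ?N = UNIV" by (simp add: space_PiM)
  have D[measurable]: "D m \<in> sets ?N" for m
  proof -
    have "{z \<in> space ?N. \<exists>n\<ge>m. \<delta> < C * \<bar>(\<Sum>i<n. z i) / real n\<bar>} \<in> sets ?N" by measurable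
    then show ?thesis by (simp add: spN D_def)
  qed
  have "AE z in ?N. (\<lambda>n. (\<Sum>i<n. z i) / real n) \<longlonglongrightarrow> (\<integral>x. x \<partial>std_normal_distribution)"
    by (rule strong_law_of_large_numbers[OF std]) (use integrable_std_normal_distribution_moment[of 1] in simp)
  moreover have mean0: "(\<integral>x. x \<partial>std_normal_distribution) = 0"
    using integral_std_normal_moment_odd[of 0] by (simp add: integral_density)
  ultimately have "AE z in ?N. (\<lambda>n. (\<Sum>i<n. z i) / real n) \<longlonglongrightarrow> 0"
    by (simp only: mean0)
  then have "AE z in ?N. z \<notin> (\<Inter>m. D m)"
  proof eventually_elim
    case (elim z)
    then have "(\<lambda>n. C * \<bar>(\<Sum>i<n. z i) / real n\<bar>) \<longlonglongrightarrow> C * \<bar>0\<bar>" by (intro tendsto_intros)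
    then have "\<forall>\<^sub>F n in sequentially. C * \<bar>(\<Sum>i<n. z i) / real n\<bar> < \<delta>"
      using \<delta> by (intro order_tendstoD(2)) auto
    then obtain m where "\<forall>n\<ge>m. C * \<bar>(\<Sum>i<n. z i) / real n\<bar> < \<delta>" by (auto simp: eventually_sequentially)
    then have "z \<notin> D m" by (force simp: D_def)
    then show ?case by blast
  qed
  then have "(\<Inter>m. D m) \<in> null_sets ?N"
    by (subst AE_iff_null_sets) auto
  then have "emeasure ?N (\<Inter>m. D m) = 0" by auto
  moreover have "(\<lambda>m. emeasure ?N (D m)) \<longlonglongrightarrow> emeasure ?N (\<Inter>m. D m)"
  proof (rule Lim_emeasure_decseq)
    show "decseq D" by (auto simp: decseq_def D_def intro: order_trans)
  qed (use D in auto)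
  ultimately have "(\<lambda>m. emeasure ?N (D m)) \<longlonglongrightarrow> 0" by simp
  then have "\<forall>\<^sub>F m in sequentially. emeasure ?N (D m) < ennreal \<epsilon>"
    using \<epsilon> by (intro order_tendstoD(2)) auto
  then have "\<forall>\<^sub>F m in sequentially. emeasure ?N (D m) < ennreal \<epsilon> \<and> 1 \<le> m"
    using eventually_ge_at_top by (rule eventually_conj)
  then obtain m where m: "emeasure ?N (D m) < ennreal \<epsilon>" "1 \<le> m"
    using eventually_happens trivial_limit_sequentially by blast
  show ?thesis
  proof (intro exI[of _ m] conjI m(2) allI impI)
    fix v :: real assume v: "0 \<le> v" "sqrt v \<le> C"
    let ?f = "\<lambda>z. \<theta> + sqrt v * z"
    let ?B = "{y. \<exists>n\<ge>m. \<delta> < \<bar>(\<Sum>i<n. y i) / real n - \<theta>\<bar>}"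
    have fm: "?f \<in> std_normal_distribution \<rightarrow>\<^sub>M borel" by simp
    have mm: "(\<lambda>z i. ?f (z i)) \<in> ?N \<rightarrow>\<^sub>M PiM UNIV (\<lambda>_. borel)"
      by (rule measurable_PiM_single') auto
    have B: "?B \<in> sets (PiM UNIV (\<lambda>_. borel))"
    proof -
      have "{y \<in> space (PiM UNIV (\<lambda>_::nat. borel)). \<exists>n\<ge>m. \<delta> < \<bar>(\<Sum>i<n. y i) / real n - \<theta>\<bar>} \<in> sets (PiM UNIV (\<lambda>_::nat. borel))"
        by measurable
      then show ?thesis by (simp add: space_PiM)
    qed
    have "PiM UNIV (\<lambda>_::nat. normal_law \<theta> v) = distr ?N (PiM UNIV (\<lambda>_. borel)) (\<lambda>z i. ?f (z i))"
      by (simp add: distr_PiM_nat_map[OF std fm] normal_law_eq_distr[OF v(1)])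
    then have "emeasure (PiM UNIV (\<lambda>_::nat. normal_law \<theta> v)) ?B = emeasure ?N {z. (\<lambda>i. ?f (z i)) \<in> ?B}"
      using emeasure_distr[OF mm B] by (simp add: vimage_def spN)
    also have "\<dots> \<le> emeasure ?N (D m)"
    proof (rule emeasure_mono[OF subsetI D])
      fix z assume "z \<in> {z. (\<lambda>i. ?f (z i)) \<in> ?B}"
      then obtain n where n: "n \<ge> m" "\<delta> < \<bar>(\<Sum>i<n. ?f (z i)) / real n - \<theta>\<bar>" by auto
      have "(\<Sum>i<n. ?f (z i)) / real n - \<theta> = sqrt v * ((\<Sum>i<n. z i) / real n)"
        using n(1) m(2) by (simp add: sum.distrib sum_distrib_left[symmetric] field_simps)
      then have "\<bar>(\<Sum>i<n. ?f (z i)) / real n - \<theta>\<bar> \<le> C * \<bar>(\<Sum>i<n. z i) / real n\<bar>"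
        using v by (simp only: abs_mult) (intro mult_right_mono, auto)
      with n show "z \<in> D m" unfolding D_def by (intro CollectI exI[of _ n]) linarith
    qed
    finally show "emeasure (PiM UNIV (\<lambda>_::nat. normal_law \<theta> v)) ?B < ennreal \<epsilon>"
      using m(1) by (rule le_less_trans)
  qed
qed

context canonical_experiment
begin

lemma measurable_pulls_Q [measurable]: "pulls a t \<in> Q \<rightarrow>\<^sub>M count_space UNIV"
  by (simp add: measurable_cong_sets[OF sets_Q refl] measurable_pulls)

lemma measurable_arm_mean_Q [measurable]: "arm_mean a t \<in> borel_measurable Q"
  by (simp add: measurable_cong_sets[OF sets_Q refl] measurable_arm_mean)

text \<open>The events decrease in t because pull counts never fall, so almost sure divergence
  passes to probabilities by continuity from above.\<close>

lemma few_pulls: "(\<lambda>t. emeasure Q {s. pulls a t s < m}) \<longlonglongrightarrow> 0"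
proof -
  have S: "{s. pulls a t s < m} \<in> sets Q" for t
  proof -
    have "{s \<in> space Q. pulls a t s < m} \<in> sets Q" by measurable
    then show ?thesis by simp
  qed
  have "(\<lambda>t. emeasure Q {s. pulls a t s < m}) \<longlonglongrightarrow> emeasure Q (\<Inter>t. {s. pulls a t s < m})"
    using S by (intro Lim_emeasure_decseq) (auto simp: decseq_def intro: le_less_trans[OF pulls_mono])
  moreover have "(\<Inter>t. {s. pulls a t s < m}) \<in> null_sets Q"
  proof (rule AE_iff_null_sets[THEN iffD2])
    show "AE s in Q. s \<notin> (\<Inter>t. {s. pulls a t s < m})"
      using pulls_at_top[of a]
    proof eventually_elim
      case (elim s)
      then obtain t where "m \<le> pulls a t s"
        unfolding filterlim_at_top eventually_sequentially by blast
      then show ?case by (auto simp: not_less)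
    qed
  qed (use S in auto)
  ultimately show ?thesis by (simp add: null_setsD1)
qed

text \<open>The pull count may depend on the rewards, so it cannot be treated as fixed; on this
  event it is some n from m on, and the tail allows all of them.\<close>

lemma deviation_le_tail:
  assumes "1 \<le> m"
  shows "emeasure Q {s. m \<le> pulls a T s \<and> \<delta> < \<bar>arm_mean a T s - \<theta>\<bar>} \<le>
    emeasure (PiM UNIV (\<lambda>_. P a)) {y. \<exists>n\<ge>m. \<delta> < \<bar>(\<Sum>i<n. y i) / real n - \<theta>\<bar>}"
proof -
  let ?B = "{y. \<exists>n\<ge>m. \<delta> < \<bar>(\<Sum>i<n. y i) / real n - \<theta>\<bar>}"
  have B: "?B \<in> sets (PiM UNIV (\<lambda>_. P a))"
  proof -
    have "{y \<in> space (PiM UNIV (\<lambda>_::nat. borel)). \<exists>n\<ge>m. \<delta> < \<bar>(\<Sum>i<n. y i) / real n - \<theta>\<bar>} \<in> sets (PiM UNIV (\<lambda>_::nat. borel))"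
      by measurable
    moreover have "sets (PiM UNIV (\<lambda>_::nat. borel)) = sets (PiM UNIV (\<lambda>_::nat. P a))"
      by (intro sets_PiM_cong) (simp_all add: arm_distsD(2)[OF arms])
    ultimately show ?thesis by (simp add: space_PiM)
  qed
  have "emeasure Q {s. m \<le> pulls a T s \<and> \<delta> < \<bar>arm_mean a T s - \<theta>\<bar>} \<le> emeasure Q ((\<lambda>s n. reward a n s) -` ?B \<inter> space Q)"
  proof (rule emeasure_mono)
    show "{s. m \<le> pulls a T s \<and> \<delta> < \<bar>arm_mean a T s - \<theta>\<bar>} \<subseteq> (\<lambda>s n. reward a n s) -` ?B \<inter> space Q"
    proof
      fix s assume s: "s \<in> {s. m \<le> pulls a T s \<and> \<delta> < \<bar>arm_mean a T s - \<theta>\<bar>}"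
      moreover have "arm_mean a T s = (\<Sum>n<pulls a T s. reward a n s) / real (pulls a T s)"
        using sum_pulled[of "\<lambda>x. x" s T a] by (simp only: arm_mean_def)
      ultimately show "s \<in> (\<lambda>s n. reward a n s) -` ?B \<inter> space Q" by auto
    qed
    show "(\<lambda>s n. reward a n s) -` ?B \<inter> space Q \<in> sets Q"
      by (rule measurable_sets[OF measurable_rewards B])
  qed
  also have "\<dots> = emeasure (PiM UNIV (\<lambda>_. P a)) ?B"
    using emeasure_distr[OF measurable_rewards B] by (simp add: distr_rewards)
  finally show ?thesis .
qed

end

lemma canonical_experimentI:
  fixes \<pi> :: "'k::finite design"
  assumes "is_design \<pi>" "infinite_sampling \<pi>" "arm_dists P"
  obtains Q where "canonical_experiment \<pi> P Q"
  using ex_canonical_experiment[OF assms(1,3)] assms by (auto simp: canonical_experiment_def)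

text \<open>
  The number of pulls is compared with that of the limit experiment only at a fixed time
  \<open>t\<^sub>0\<close>, where total variation continuity applies; monotonicity in time does the rest.
\<close>

lemma simulated_mean_consistent:
  fixes \<pi> :: "'k::finite design" and m v :: "nat \<Rightarrow> 'k \<Rightarrow> real"
  assumes d: "is_design \<pi>" and samp: "infinite_sampling \<pi>"
    and m: "\<And>a. (\<lambda>T. m T a) \<longlonglongrightarrow> m' a" and v: "\<And>a. (\<lambda>T. v T a) \<longlonglongrightarrow> v' a"
    and v0: "\<And>T a. 0 \<le> v T a"
    and dg: "\<And>a. v' a = 0 \<Longrightarrow> \<forall>\<^sub>F T in sequentially. m T a = m' a \<and> v T a = 0"
    and \<theta>: "\<And>T. m T a\<^sub>1 = \<theta>" and \<delta>: "0 < \<delta>"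
  shows "(\<lambda>T. emeasure (traj_law \<pi> (\<lambda>a. normal_law (m T a) (v T a)) T)
      {h \<in> space (hist_space T). \<delta> < \<bar>arm_mean a\<^sub>1 T h - \<theta>\<bar>}) \<longlonglongrightarrow> 0"
proof (rule tendsto_zero_ennreal)
  \<comment> \<open>One third each for too few pulls at time \<open>t0\<close> under the limit arms,
    for the total variation error at time \<open>t0\<close>, and for the tail of long averages. The
    choices are made in the order \<open>k\<close>, \<open>t0\<close>, T.\<close>
  fix \<epsilon> :: real assume \<epsilon>: "0 < \<epsilon>"
  then have e3: "0 < \<epsilon> / 3" by simp
  have v'0: "0 \<le> v' a" for a by (rule LIMSEQ_le_const[OF v]) (use v0 in auto)
  define p where "p T a = normal_law (m T a) (v T a)" for T a
  define p' where "p' a = normal_law (m' a) (v' a)" for a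
  have p: "arm_dists (p T)" for T unfolding p_def by (rule arm_dists_normal_law) (rule v0)
  have p': "arm_dists p'" unfolding p'_def by (rule arm_dists_normal_law) (rule v'0)
  have "\<forall>a. \<exists>c. c \<longlonglongrightarrow> (0::ennreal) \<and> (\<forall>n g. g \<in> borel_measurable borel \<longrightarrow> (\<forall>x. g x \<le> 1) \<longrightarrow>
    (\<integral>\<^sup>+x. g x \<partial>p n a) \<le> (\<integral>\<^sup>+x. g x \<partial>p' a) + c n)"
    unfolding p_def p'_def by (intro allI normal_law_perturb m v v0 v'0 dg)
  from choice[OF this] obtain c where c': "\<forall>a. c a \<longlonglongrightarrow> (0::ennreal) \<and>
    (\<forall>n g. g \<in> borel_measurable borel \<longrightarrow> (\<forall>x. g x \<le> 1) \<longrightarrow>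
      (\<integral>\<^sup>+x. g x \<partial>p n a) \<le> (\<integral>\<^sup>+x. g x \<partial>p' a) + c a n)" ..
  have c: "c a \<longlonglongrightarrow> 0" for a using c' by blast
  define C where "C T = (\<Sum>a\<in>UNIV. c a T)" for T
  have "(\<lambda>T. \<Sum>a\<in>UNIV. c a T) \<longlonglongrightarrow> (\<Sum>a\<in>(UNIV :: 'k set). 0)"
    by (rule tendsto_sum) (rule c)
  then have C: "C \<longlonglongrightarrow> 0" by (simp add: C_def[abs_def])
  \<comment> \<open>The summand 1 leaves room for \<open>K\<close> to bound the standard deviation
    of arm 1 for all large T, so that \<open>k\<close> does not depend on T.\<close>
  define K where "K = sqrt (v' a\<^sub>1) + 1"
  obtain k where k: "1 \<le> k" and tail: "\<And>v. 0 \<le> v \<Longrightarrow> sqrt v \<le> K \<Longrightarrow>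
    emeasure (PiM UNIV (\<lambda>_::nat. normal_law \<theta> v)) {y. \<exists>n\<ge>k. \<delta> < \<bar>(\<Sum>i<n. y i) / real n - \<theta>\<bar>} < ennreal (\<epsilon> / 3)"
    using normal_average_tail[OF \<delta> e3, of K \<theta>] by blast
  obtain Q' where "canonical_experiment \<pi> p' Q'" using canonical_experimentI[OF d samp p'] .
  then interpret Q': canonical_experiment \<pi> p' Q' .
  have "\<forall>\<^sub>F t in sequentially. emeasure Q' {s. pulls a\<^sub>1 t s < k} < ennreal (\<epsilon> / 3)"
    using Q'.few_pulls e3 by (intro order_tendstoD(2)) auto
  then obtain t0 where t0: "emeasure Q' {s. pulls a\<^sub>1 t0 s < k} < ennreal (\<epsilon> / 3)"
    using eventually_happens trivial_limit_sequentially by blast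
  have "(\<lambda>T. of_nat t0 * C T) \<longlonglongrightarrow> of_nat t0 * 0"
    by (rule ennreal_tendsto_cmult[OF of_nat_less_top C])
  then have ev1: "\<forall>\<^sub>F T in sequentially. of_nat t0 * C T < ennreal (\<epsilon> / 3)"
    using e3 by (intro order_tendstoD(2)) auto
  have "(\<lambda>T. sqrt (v T a\<^sub>1)) \<longlonglongrightarrow> sqrt (v' a\<^sub>1)" by (intro tendsto_intros v)
  then have ev2: "\<forall>\<^sub>F T in sequentially. sqrt (v T a\<^sub>1) < K"
    by (rule order_tendstoD(2)) (simp add: K_def)
  show "\<forall>\<^sub>F T in sequentially. emeasure (traj_law \<pi> (\<lambda>a. normal_law (m T a) (v T a)) T)
      {h \<in> space (hist_space T). \<delta> < \<bar>arm_mean a\<^sub>1 T h - \<theta>\<bar>} < ennreal \<epsilon>"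
    using ev1 ev2 eventually_ge_at_top[of t0]
  proof eventually_elim
    case (elim T)
    obtain Q where "canonical_experiment \<pi> (p T) Q" using canonical_experimentI[OF d samp p] .
    then interpret Q: canonical_experiment \<pi> "p T" Q .
    let ?E = "\<lambda>t. {h \<in> space (hist_space t). pulls a\<^sub>1 t h < k}"
    have E: "?E t \<in> sets (hist_space t)" for t
    proof -
      have [measurable]: "pulls a\<^sub>1 t \<in> hist_space t \<rightarrow>\<^sub>M count_space UNIV" by (rule measurable_pulls) simp
      show ?thesis by measurable
    qed
    have rE: "{s. restrict s {0..<t} \<in> ?E t} = {s. pulls a\<^sub>1 t s < k}" for t
      by (auto simp: space_PiM space_pair_measure pulls_restrict)
    let ?D = "{h \<in> space (hist_space T). \<delta> < \<bar>arm_mean a\<^sub>1 T h - \<theta>\<bar>}"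
    have D: "?D \<in> sets (hist_space T)"
    proof -
      have [measurable]: "arm_mean a\<^sub>1 T \<in> borel_measurable (hist_space T)" by (rule measurable_arm_mean) simp
      show ?thesis by measurable
    qed
    have rD: "{s. restrict s {0..<T} \<in> ?D} = {s. \<delta> < \<bar>arm_mean a\<^sub>1 T s - \<theta>\<bar>}"
      by (auto simp: space_PiM space_pair_measure arm_mean_restrict)
    \<comment> \<open>The event is decided by the first \<open>t0\<close> rounds, so the two
      experiments are compared at that length and the error carries the fixed factor
      \<open>t0\<close> instead of T.\<close>
    have few: "emeasure Q {s. pulls a\<^sub>1 t0 s < k} \<le> emeasure Q' {s. pulls a\<^sub>1 t0 s < k} + of_nat t0 * C T"
    proof -
      have *: "sets (traj_law \<pi> q t0) = sets (hist_space t0)" if "arm_dists q" for q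
        using traj_law_in_prob_algebra[where P=q and t=t0, OF d arm_distsD(1)[OF that]] by (simp add: space_prob_algebra)
      have "(\<integral>\<^sup>+h. indicator (?E t0) h \<partial>traj_law \<pi> (p T) t0) \<le> (\<integral>\<^sup>+h. indicator (?E t0) h \<partial>traj_law \<pi> p' t0) + of_nat t0 * C T"
      proof (rule nn_integral_traj_law_perturb[where P="p T" and P'=p', OF d arm_distsD(1)[OF p] arm_distsD(1)[OF p']])
        fix a and g :: "real \<Rightarrow> ennreal" assume g: "g \<in> borel_measurable borel" "\<And>x. g x \<le> 1"
        have "(\<integral>\<^sup>+x. g x \<partial>p T a) \<le> (\<integral>\<^sup>+x. g x \<partial>p' a) + c a T" using c' g by blast
        also have "\<dots> \<le> (\<integral>\<^sup>+x. g x \<partial>p' a) + C T"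
          unfolding C_def by (intro add_left_mono member_le_sum) auto
        finally show "(\<integral>\<^sup>+x. g x \<partial>p T a) \<le> (\<integral>\<^sup>+x. g x \<partial>p' a) + C T" .
      qed (use E in \<open>auto split: split_indicator\<close>)
      moreover have "(\<integral>\<^sup>+h. indicator (?E t0) h \<partial>traj_law \<pi> (p T) t0) = emeasure Q {s. pulls a\<^sub>1 t0 s < k}"
        using nn_integral_indicator[of "?E t0" "traj_law \<pi> (p T) t0"] E[of t0] *[OF p]
        by (simp only: Q.emeasure_traj_law[OF E] rE)
      moreover have "(\<integral>\<^sup>+h. indicator (?E t0) h \<partial>traj_law \<pi> p' t0) = emeasure Q' {s. pulls a\<^sub>1 t0 s < k}"
        using nn_integral_indicator[of "?E t0" "traj_law \<pi> p' t0"] E[of t0] *[OF p']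
        by (simp only: Q'.emeasure_traj_law[OF E] rE)
      ultimately show ?thesis by simp
    qed
    have S: "{s. pulls a\<^sub>1 t0 s < k} \<in> sets Q" "{s. k \<le> pulls a\<^sub>1 T s \<and> \<delta> < \<bar>arm_mean a\<^sub>1 T s - \<theta>\<bar>} \<in> sets Q"
    proof -
      have "{s \<in> space Q. pulls a\<^sub>1 t0 s < k} \<in> sets Q" "{s \<in> space Q. k \<le> pulls a\<^sub>1 T s \<and> \<delta> < \<bar>arm_mean a\<^sub>1 T s - \<theta>\<bar>} \<in> sets Q"
        by measurable
      then show "{s. pulls a\<^sub>1 t0 s < k} \<in> sets Q" "{s. k \<le> pulls a\<^sub>1 T s \<and> \<delta> < \<bar>arm_mean a\<^sub>1 T s - \<theta>\<bar>} \<in> sets Q"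
        by simp_all
    qed
    have "emeasure (traj_law \<pi> (p T) T) ?D = emeasure Q {s. \<delta> < \<bar>arm_mean a\<^sub>1 T s - \<theta>\<bar>}"
      by (simp only: Q.emeasure_traj_law[OF D] rD)
    also have "\<dots> \<le> emeasure Q ({s. pulls a\<^sub>1 t0 s < k} \<union> {s. k \<le> pulls a\<^sub>1 T s \<and> \<delta> < \<bar>arm_mean a\<^sub>1 T s - \<theta>\<bar>})"
    proof (rule emeasure_mono)
      show "{s. \<delta> < \<bar>arm_mean a\<^sub>1 T s - \<theta>\<bar>} \<subseteq> {s. pulls a\<^sub>1 t0 s < k} \<union> {s. k \<le> pulls a\<^sub>1 T s \<and> \<delta> < \<bar>arm_mean a\<^sub>1 T s - \<theta>\<bar>}"
        using pulls_mono[OF elim(3), of a\<^sub>1] by (auto simp: not_less intro: order_trans)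
    qed (use S in auto)
    also have "\<dots> \<le> emeasure Q {s. pulls a\<^sub>1 t0 s < k} + emeasure Q {s. k \<le> pulls a\<^sub>1 T s \<and> \<delta> < \<bar>arm_mean a\<^sub>1 T s - \<theta>\<bar>}"
      by (rule emeasure_subadditive[OF S])
    also have "\<dots> \<le> (emeasure Q' {s. pulls a\<^sub>1 t0 s < k} + of_nat t0 * C T) + emeasure (PiM UNIV (\<lambda>_::nat. p T a\<^sub>1)) {y. \<exists>n\<ge>k. \<delta> < \<bar>(\<Sum>i<n. y i) / real n - \<theta>\<bar>}"
      by (intro add_mono few Q.deviation_le_tail k)
    also have "\<dots> < (ennreal (\<epsilon> / 3) + ennreal (\<epsilon> / 3)) + ennreal (\<epsilon> / 3)"
      using tail[OF v0, of T a\<^sub>1] elim t0 by (intro add_strict_mono) (auto simp: p_def \<theta>)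
    also have "\<dots> = ennreal \<epsilon>" using \<epsilon> by (simp flip: ennreal_plus)
    finally show ?case by (simp add: p_def[abs_def])
  qed
qed

section \<open>Rejection of wrong null values\<close>

text \<open>On cylinder sets the product law is a finite product of measurable functions of x, and
  cylinders form a generator stable under intersection.\<close>

lemma measurable_PiM_nat_kernel:
  assumes K: "K \<in> N \<rightarrow>\<^sub>M prob_algebra L"
  shows "(\<lambda>x. PiM UNIV (\<lambda>_::nat. K x)) \<in> N \<rightarrow>\<^sub>M prob_algebra (PiM UNIV (\<lambda>_. L))"
proof (rule measurable_prob_algebra_generated[OF sets_PiM Int_stable_prod_algebra prod_algebra_sets_into_space])
  fix x assume x: "x \<in> space N"
  have Kx: "prob_space (K x)" "sets (K x) = sets L"
    using measurable_space[OF K x] by (auto simp: space_prob_algebra)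
  show "prob_space (PiM UNIV (\<lambda>_::nat. K x))" by (intro prob_space_PiM Kx)
  show "sets (PiM UNIV (\<lambda>_::nat. K x)) = sets (PiM UNIV (\<lambda>_. L))" by (intro sets_PiM_cong refl Kx)
next
  fix A assume "A \<in> prod_algebra (UNIV :: nat set) (\<lambda>_. L)"
  then obtain J E where A: "A = prod_emb UNIV (\<lambda>_. L) J (Pi\<^sub>E J E)" and J: "finite J"
    and E: "\<And>i. i \<in> J \<Longrightarrow> E i \<in> sets L" unfolding prod_algebra_def by auto
  have "emeasure (PiM UNIV (\<lambda>_::nat. K x)) A = (\<Prod>j\<in>J. emeasure (K x) (E j))" if x: "x \<in> space N" for x
  proof -
    have Kx: "prob_space (K x)" "sets (K x) = sets L"
      using measurable_space[OF K x] by (auto simp: space_prob_algebra)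
    have "A = prod_emb UNIV (\<lambda>_. K x) J (Pi\<^sub>E J E)"
      by (simp add: A prod_emb_def sets_eq_imp_space_eq[OF Kx(2)])
    then show ?thesis using J E Kx by (simp add: emeasure_PiM_emb)
  qed
  moreover have "(\<lambda>x. \<Prod>j\<in>J. emeasure (K x) (E j)) \<in> borel_measurable N"
    by (intro borel_measurable_prod_ennreal measurable_emeasure_kernel[OF measurable_prob_algebraD[OF K]] E)
  ultimately show "(\<lambda>x. emeasure (PiM UNIV (\<lambda>_::nat. K x)) A) \<in> borel_measurable N"
    by (subst measurable_cong)
qed

lemma measurable_sim_law:
  fixes \<pi> :: "'k::finite design"
  assumes d: "is_design \<pi>" and dd: "d \<le> 1"
  shows "sim_law \<pi> d a\<^sub>1 T \<theta>\<^sub>0 \<in> hist_space T \<rightarrow>\<^sub>M prob_algebra (hist_space T)"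
  unfolding sim_law_def[abs_def]
proof (rule measurable_traj_law[OF d])
  fix a :: 'k
  have [measurable]: "arm_mean a T \<in> borel_measurable (hist_space T)" "arm_var d a T \<in> borel_measurable (hist_space T)"
    by (auto intro: measurable_arm_mean measurable_arm_var)
  show "(\<lambda>h. sim_arms d a\<^sub>1 T \<theta>\<^sub>0 h a) \<in> hist_space T \<rightarrow>\<^sub>M prob_algebra borel"
    unfolding sim_arms_def by (rule measurable_normal_law) (auto intro: arm_var_nonneg[OF dd])
qed

text \<open>Given the data h, the trajectories are i.i.d. and the threshold is a constant, so the
  strong law applies to an indicator. The exceptional sets depend on h and are put together by
  integrating over the law of the data.\<close>

lemma AE_Fhat_tendsto:
  fixes \<pi> :: "'k::finite design"
  assumes d: "is_design \<pi>" and dd: "d \<le> 1" and H: "H \<in> M \<rightarrow>\<^sub>M hist_space T"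
    and sim: "simulated \<pi> d a\<^sub>1 T M H (\<lambda>_. \<theta>\<^sub>0) S"
  shows "AE \<omega> in M. (\<lambda>B. (\<Sum>i<B. of_bool (arm_mean a\<^sub>1 T (S i \<omega>) \<le> arm_mean a\<^sub>1 T (H \<omega>))) / real B)
    \<longlonglongrightarrow> measure (sim_law \<pi> d a\<^sub>1 T \<theta>\<^sub>0 (H \<omega>)) {s \<in> space (hist_space T). arm_mean a\<^sub>1 T s \<le> arm_mean a\<^sub>1 T (H \<omega>)}"
proof -
  let ?L = "hist_space T :: 'k history measure" and ?LS = "PiM UNIV (\<lambda>_::nat. hist_space T :: 'k history measure)"
  define K where "K = sim_law \<pi> d a\<^sub>1 T \<theta>\<^sub>0"
  define F where "F h = measure (K h) {s \<in> space ?L. arm_mean a\<^sub>1 T s \<le> arm_mean a\<^sub>1 T h}" for h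
  \<comment> \<open>Convergence spelled out with countably many tolerances: \<open>AE_bind\<close>
    needs it as a predicate jointly measurable in the data and the simulated trajectories.\<close>
  define R where "R h y \<longleftrightarrow> (\<forall>k. \<forall>\<^sub>F B in sequentially.
    \<bar>(\<Sum>i<B. of_bool (arm_mean a\<^sub>1 T (y i) \<le> arm_mean a\<^sub>1 T h)) / real B - F h\<bar> < 1 / real (Suc k))"
    for h :: "'k history" and y
  have K: "K \<in> ?L \<rightarrow>\<^sub>M prob_algebra ?L" unfolding K_def by (rule measurable_sim_law[OF d dd])
  have am[measurable]: "arm_mean a\<^sub>1 T \<in> borel_measurable ?L" by (rule measurable_arm_mean) simp
  have F[measurable]: "F \<in> borel_measurable ?L"
    unfolding F_def
  proof (rule measure_measurable_prob_algebra2[OF _ K])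
    have "{p \<in> space (?L \<Otimes>\<^sub>M ?L). arm_mean a\<^sub>1 T (snd p) \<le> arm_mean a\<^sub>1 T (fst p)} \<in> sets (?L \<Otimes>\<^sub>M ?L)" by measurable
    also have "{p \<in> space (?L \<Otimes>\<^sub>M ?L). arm_mean a\<^sub>1 T (snd p) \<le> arm_mean a\<^sub>1 T (fst p)} =
       Sigma (space ?L) (\<lambda>h. {s \<in> space ?L. arm_mean a\<^sub>1 T s \<le> arm_mean a\<^sub>1 T h})"
      by (auto simp: space_pair_measure)
    finally show "Sigma (space ?L) (\<lambda>h. {s \<in> space ?L. arm_mean a\<^sub>1 T s \<le> arm_mean a\<^sub>1 T h}) \<in> sets (?L \<Otimes>\<^sub>M ?L)" .
  qed
  have R[measurable]: "Measurable.pred (?L \<Otimes>\<^sub>M ?LS) (\<lambda>z. R (fst z) (snd z))"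
  proof -
    have 1: "(\<lambda>z. arm_mean a\<^sub>1 T (fst z)) \<in> borel_measurable (?L \<Otimes>\<^sub>M ?LS)"
      "(\<lambda>z. F (fst z)) \<in> borel_measurable (?L \<Otimes>\<^sub>M ?LS)"
      by (rule measurable_compose[OF measurable_fst], fact)+
    have "(\<lambda>z. snd z i) \<in> ?L \<Otimes>\<^sub>M ?LS \<rightarrow>\<^sub>M ?L" for i
      by (rule measurable_compose[OF measurable_snd]) simp
    then have 2: "(\<lambda>z. arm_mean a\<^sub>1 T (snd z i)) \<in> borel_measurable (?L \<Otimes>\<^sub>M ?LS)" for i
      by (rule measurable_compose[OF _ am])
    have "(\<lambda>z. of_bool (arm_mean a\<^sub>1 T (snd z i) \<le> arm_mean a\<^sub>1 T (fst z)) :: real) \<in> borel_measurable (?L \<Otimes>\<^sub>M ?LS)" for i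
      unfolding of_bool_def using 1(1) 2[of i] by (intro measurable_If borel_measurable_le) auto
    then have 3: "(\<lambda>z. \<bar>(\<Sum>i<B. of_bool (arm_mean a\<^sub>1 T (snd z i) \<le> arm_mean a\<^sub>1 T (fst z))) / real B - F (fst z)\<bar>)
        \<in> borel_measurable (?L \<Otimes>\<^sub>M ?LS)" for B
      using 1(2) by (intro borel_measurable_abs borel_measurable_diff borel_measurable_divide borel_measurable_sum) auto
    show ?thesis
      unfolding R_def eventually_sequentially
      by (intro pred_intros_countable pred_intros_logic borel_measurable_pred_less 3) auto
  qed
  define k where "k h = distr (PiM UNIV (\<lambda>_::nat. K h)) (?L \<Otimes>\<^sub>M ?LS) (Pair h)" for h
  have k: "k \<in> ?L \<rightarrow>\<^sub>M prob_algebra (?L \<Otimes>\<^sub>M ?LS)"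
    unfolding k_def by (rule measurable_distr_prob_space2[OF measurable_PiM_nat_kernel[OF K]]) simp
  have Sm: "\<And>i. S i \<in> M \<rightarrow>\<^sub>M ?L" and
    law: "distr M (?L \<Otimes>\<^sub>M ?LS) (\<lambda>\<omega>. (H \<omega>, \<lambda>i. S i \<omega>)) = distr M ?L H \<bind> k"
    using sim unfolding simulated_def k_def K_def by auto
  have "(\<lambda>\<omega> i. S i \<omega>) \<in> M \<rightarrow>\<^sub>M ?LS"
    by (rule measurable_PiM_single') (use Sm in \<open>auto dest: measurable_space\<close>)
  with H have HS: "(\<lambda>\<omega>. (H \<omega>, \<lambda>i. S i \<omega>)) \<in> M \<rightarrow>\<^sub>M ?L \<Otimes>\<^sub>M ?LS" by simp
  have "AE z in k h. R (fst z) (snd z)" if h: "h \<in> space ?L" for h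
  proof -
    have Kh: "prob_space (K h)" and sK: "sets (K h) = sets ?L"
      using measurable_space[OF K h] by (auto simp: space_prob_algebra)
    interpret Kh: prob_space "K h" by (rule Kh)
    let ?A = "{s \<in> space ?L. arm_mean a\<^sub>1 T s \<le> arm_mean a\<^sub>1 T h}"
    have A: "?A \<in> sets (K h)" unfolding sK by measurable
    have spK: "space (K h) = space ?L" by (rule sets_eq_imp_space_eq[OF sK])
    have "AE y in PiM UNIV (\<lambda>_::nat. K h). (\<lambda>B. (\<Sum>i<B. indicator ?A (y i)) / real B) \<longlonglongrightarrow> (\<integral>s. indicator ?A s \<partial>K h)"
      by (rule strong_law_of_large_numbers[OF Kh]) (use A in \<open>auto simp: less_top[symmetric]\<close>)
    then have "AE y in PiM UNIV (\<lambda>_::nat. K h). R h y"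
      using AE_space
    proof eventually_elim
      case (elim y)
      have "indicator ?A (y i) = (of_bool (arm_mean a\<^sub>1 T (y i) \<le> arm_mean a\<^sub>1 T h) :: real)" for i
        using elim(2) by (auto simp: space_PiM spK indicator_def)
      moreover have "(\<integral>s. indicator ?A s \<partial>K h) = F h"
        using A sets.sets_into_space[OF A] by (simp add: F_def Int_absorb2)
      ultimately have "(\<lambda>B. (\<Sum>i<B. of_bool (arm_mean a\<^sub>1 T (y i) \<le> arm_mean a\<^sub>1 T h)) / real B) \<longlonglongrightarrow> F h"
        using elim(1) by simp
      then show ?case unfolding R_def LIMSEQ_iff_inverse_Suc .
    qed
    moreover have "Pair h \<in> PiM UNIV (\<lambda>_::nat. K h) \<rightarrow>\<^sub>M ?L \<Otimes>\<^sub>M ?LS"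
    proof -
      have eq: "sets (PiM UNIV (\<lambda>_::nat. K h)) = sets ?LS" by (intro sets_PiM_cong refl sK)
      show ?thesis
        unfolding measurable_cong_sets[OF eq refl] by (rule measurable_Pair1'[OF h])
    qed
    ultimately show ?thesis
      unfolding k_def by (subst AE_distr_iff) (use R in auto)
  qed
  then have "AE h in distr M ?L H. AE z in k h. R (fst z) (snd z)"
    by (rule AE_I2) simp
  moreover have "k \<in> distr M ?L H \<rightarrow>\<^sub>M subprob_algebra (?L \<Otimes>\<^sub>M ?LS)"
    using measurable_prob_algebraD[OF k] by simp
  ultimately have "AE z in distr M ?L H \<bind> k. R (fst z) (snd z)"
    using AE_bind[OF _ R] by blast
  from AE_distrD[OF HS this[folded law]] have "AE \<omega> in M. R (H \<omega>) (\<lambda>i. S i \<omega>)" by simp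
  then show ?thesis
    by eventually_elim (simp add: LIMSEQ_iff_inverse_Suc R_def F_def K_def)
qed

text \<open>The simulated mean concentrates at \<theta> while the threshold \<open>x T\<close>
  settles at x', so the distribution function at the threshold is close to 0 or to 1, according to
  which of the two is larger.\<close>

lemma wrong_null_rejected:
  fixes \<pi> :: "'k::finite design" and m v :: "nat \<Rightarrow> 'k \<Rightarrow> real"
  assumes d: "is_design \<pi>" and samp: "infinite_sampling \<pi>"
    and m: "\<And>a. (\<lambda>T. m T a) \<longlonglongrightarrow> m' a" and v: "\<And>a. (\<lambda>T. v T a) \<longlonglongrightarrow> v' a"
    and v0: "\<And>T a. 0 \<le> v T a"
    and dg: "\<And>a. v' a = 0 \<Longrightarrow> \<forall>\<^sub>F T in sequentially. m T a = m' a \<and> v T a = 0"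
    and \<theta>: "\<And>T. m T a\<^sub>1 = \<theta>" and x: "x \<longlonglongrightarrow> x'" and ne: "\<theta> \<noteq> x'" and \<epsilon>: "0 < \<epsilon>"
  shows "\<forall>\<^sub>F T in sequentially. measure (traj_law \<pi> (\<lambda>a. normal_law (m T a) (v T a)) T)
      {h \<in> space (hist_space T). arm_mean a\<^sub>1 T h \<le> x T} \<notin> {\<epsilon>..1 - \<epsilon>}"
proof -
  \<comment> \<open>Half the gap: a simulated mean within \<delta> of \<theta> and a threshold
    strictly within \<delta> of x' are ordered like \<theta> and x'.\<close>
  define \<delta> where "\<delta> = \<bar>\<theta> - x'\<bar> / 2"
  have \<delta>: "0 < \<delta>" using ne by (simp add: \<delta>_def)
  have ev1: "\<forall>\<^sub>F T in sequentially. emeasure (traj_law \<pi> (\<lambda>a. normal_law (m T a) (v T a)) T)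
      {h \<in> space (hist_space T). \<delta> < \<bar>arm_mean a\<^sub>1 T h - \<theta>\<bar>} < ennreal \<epsilon>"
    by (rule order_tendstoD(2)[OF simulated_mean_consistent[where m=m and v=v and m'=m' and v'=v' and \<theta>=\<theta>, OF d samp m v v0 dg \<theta> \<delta>]]) (use \<epsilon> in auto)
  have ev2: "\<forall>\<^sub>F T in sequentially. \<bar>x T - x'\<bar> < \<delta>"
    using tendstoD[OF x \<delta>] by (simp add: dist_real_def)
  show ?thesis
    using ev1 ev2
  proof eventually_elim
    case (elim T)
    define L where "L = traj_law \<pi> (\<lambda>a. normal_law (m T a) (v T a)) T"
    have "L \<in> space (prob_algebra (hist_space T))"
      unfolding L_def by (intro traj_law_in_prob_algebra d arm_distsD(1) arm_dists_normal_law v0)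
    then have sL: "sets L = sets (hist_space T)" and "prob_space L" by (auto simp: space_prob_algebra)
    then interpret L: prob_space L by simp
    have spL: "space L = space (hist_space T)" by (rule sets_eq_imp_space_eq[OF sL])
    have am: "arm_mean a\<^sub>1 T \<in> borel_measurable L"
      unfolding measurable_cong_sets[OF sL refl] by (rule measurable_arm_mean) simp
    let ?E = "{h \<in> space L. \<delta> < \<bar>arm_mean a\<^sub>1 T h - \<theta>\<bar>}" and ?A = "{h \<in> space L. arm_mean a\<^sub>1 T h \<le> x T}"
    have S: "?E \<in> sets L" "?A \<in> sets L" using am by measurable
    have E: "measure L ?E < \<epsilon>"
      using elim(1) \<epsilon> by (simp add: L_def[symmetric] spL[symmetric] L.emeasure_eq_measure ennreal_less_iff)
    show ?case
    proof (cases "x' < \<theta>")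
      case True
      have "?A \<subseteq> ?E" using True elim(2) by (auto simp: \<delta>_def abs_if field_simps split: if_splits)
      then have "measure L ?A \<le> measure L ?E" using S by (intro L.finite_measure_mono)
      then show ?thesis using E by (simp add: L_def[symmetric] spL[symmetric])
    next
      case False
      then have "\<theta> < x'" using ne by simp
      then have "space L - ?A \<subseteq> ?E" using elim(2) by (auto simp: \<delta>_def abs_if field_simps split: if_splits)
      then have "measure L (space L - ?A) \<le> measure L ?E" using S by (intro L.finite_measure_mono)
      then show ?thesis using E S by (simp add: L_def[symmetric] spL[symmetric] L.prob_compl)
    qed
  qed
qed

section \<open>Distance bounds for the iterated limit\<close>

lemma hausdorff_dist_singleton_le:
  fixes t :: "'a::metric_space"
  assumes "x \<in> C" "C \<subseteq> {x, t}"
  shows "hausdorff_dist C {t} \<le> dist x t"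
proof -
  have "(SUP y\<in>C. infdist y {t}) \<le> dist x t"
    using assms by (intro cSUP_least) auto
  moreover have "(SUP y\<in>{t}. infdist y C) \<le> dist x t"
    using assms infdist_le[of x C t] by (simp add: dist_commute)
  ultimately show ?thesis by (simp add: hausdorff_dist_def)
qed

lemma hausdorff_dist_singleton_nonneg: "0 \<le> hausdorff_dist C {t}"
  by (simp add: hausdorff_dist_def infdist_nonneg le_max_iff_disj)

text \<open>The inner limit over B is a limsup because it need not exist: at the true value the
  limit of \<open>Fhat\<close> may be an endpoint of the acceptance interval, and membership in
  \<open>Chat\<close> can then alternate forever.\<close>

lemma limsup_tendsto_0I:
  fixes f :: "nat \<Rightarrow> nat \<Rightarrow> real"
  assumes "\<And>T B. 0 \<le> f T B" and "\<forall>\<^sub>F T in sequentially. \<forall>\<^sub>F B in sequentially. f T B \<le> e T" and "e \<longlonglongrightarrow> 0"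
  shows "(\<lambda>T. limsup (\<lambda>B. ereal (f T B))) \<longlonglongrightarrow> 0"
proof (rule tendsto_sandwich[of "\<lambda>_. 0" _ _ "\<lambda>T. ereal (e T)"])
  show "\<forall>\<^sub>F T in sequentially. 0 \<le> limsup (\<lambda>B. ereal (f T B))"
    using assms(1) by (intro always_eventually allI le_Limsup) auto
  show "\<forall>\<^sub>F T in sequentially. limsup (\<lambda>B. ereal (f T B)) \<le> ereal (e T)"
    using assms(2) by eventually_elim (intro Limsup_bounded, simp)
  show "(\<lambda>T. ereal (e T)) \<longlonglongrightarrow> 0"
    using assms(3) by (simp add: zero_ereal_def)
qed simp

text \<open>On almost every path all arm estimates converge and wrong null values drop out; the
  finite grid gives them a common T and, for each such T, a common B. A positive level is essential:
  for \<alpha> = 0 the acceptance interval is [0, 1] and every grid value is retained. Simulations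
  under different null values are given no joint law; almost sure facts about each are
  combined.\<close>

theorem lemma2:
  fixes \<pi> :: "'k::finite design"
    and P :: "'k \<Rightarrow> real measure"
    and a\<^sub>1 :: 'k
    and M :: "'w measure"
    and A :: "nat \<Rightarrow> 'w \<Rightarrow> 'k"
    and X :: "nat \<Rightarrow> 'w \<Rightarrow> real"
    and sim :: "nat \<Rightarrow> real \<Rightarrow> nat \<Rightarrow> 'w \<Rightarrow> 'k history"
    and \<Theta>\<^sub>0 :: "real set"
    and \<alpha> :: real
    and d :: nat
    and \<theta>_hat :: "nat \<Rightarrow> nat \<Rightarrow> 'w \<Rightarrow> real"
  assumes design: "is_design \<pi>" "infinite_sampling \<pi>"
    and arms: "arm_dists P" "\<And>a. finite_variance (P a)"
    and data: "bandit_experiment \<pi> P M A X"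
    and grid: "finite \<Theta>\<^sub>0" "mean (P a\<^sub>1) \<in> \<Theta>\<^sub>0"
    and level: "0 < \<alpha>" "\<alpha> \<le> 1"
    and ddof: "d \<le> 1"
    and sim: "\<And>T g. g \<in> {arm_mean a\<^sub>1 T} \<union> {\<lambda>_. \<theta>\<^sub>0 | \<theta>\<^sub>0. \<theta>\<^sub>0 \<in> \<Theta>\<^sub>0} \<Longrightarrow>
      simulated \<pi> d a\<^sub>1 T M (hist A X T) g (\<lambda>i \<omega>. sim T (g (hist A X T \<omega>)) i \<omega>)"
    and estimate: "\<And>T B \<omega>. \<omega> \<in> space M \<Longrightarrow>
      is_arg_min (\<lambda>\<theta>. \<bar>Fhat a\<^sub>1 T B (hist A X T \<omega>) (\<lambda>\<theta>\<^sub>0 i. sim T \<theta>\<^sub>0 i \<omega>) \<theta> - 1 / 2\<bar>)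
        (\<lambda>\<theta>. \<theta> \<in> Chat a\<^sub>1 T B \<Theta>\<^sub>0 \<alpha> (hist A X T \<omega>) (\<lambda>\<theta>\<^sub>0 i. sim T \<theta>\<^sub>0 i \<omega>))
        (\<theta>_hat T B \<omega>)"
  shows "(AE \<omega> in M. (\<lambda>T. limsup (\<lambda>B. ereal (hausdorff_dist
            (Chat a\<^sub>1 T B \<Theta>\<^sub>0 \<alpha> (hist A X T \<omega>) (\<lambda>\<theta>\<^sub>0 i. sim T \<theta>\<^sub>0 i \<omega>)) {mean (P a\<^sub>1)})))
              \<longlonglongrightarrow> 0)
       \<and> (AE \<omega> in M. (\<lambda>T. limsup (\<lambda>B. ereal \<bar>\<theta>_hat T B \<omega> - mean (P a\<^sub>1)\<bar>)) \<longlonglongrightarrow> 0)"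
proof -
  define S where "S = (\<lambda>\<omega> t. (A t \<omega>, X t \<omega>))"
  define Q where "Q = distr M (PiM UNIV (\<lambda>_. round_space)) S"
  have S: "S \<in> M \<rightarrow>\<^sub>M PiM UNIV (\<lambda>_. round_space)"
    and Q: "bandit_experiment \<pi> P Q (\<lambda>t s. fst (s t)) (\<lambda>t s. snd (s t))"
    using bandit_experiment_seq[OF data] by (simp_all add: S_def Q_def)
  interpret E: canonical_experiment \<pi> P Q
    using design arms(1) Q by unfold_locales (simp_all add: Q_def)
  have hist_eq: "hist A X T \<omega> = restrict (S \<omega>) {0..<T}" for T \<omega>
    by (simp add: hist_def S_def)
  have H: "hist A X T \<in> M \<rightarrow>\<^sub>M hist_space T" for T
    unfolding hist_eq[abs_def] by (rule measurable_compose[OF S measurable_restrict_subset]) simp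
  define V where "V a = (\<integral>x. (x - mean (P a))\<^sup>2 \<partial>P a)" for a
  have "AE s in Q. \<forall>a\<in>UNIV. (\<lambda>T. arm_mean a T s) \<longlonglongrightarrow> mean (P a)"
    by (intro AE_finite_allI E.AE_arm_mean) auto
  moreover have "AE s in Q. \<forall>a\<in>UNIV. (\<lambda>T. arm_var d a T s) \<longlonglongrightarrow> V a"
    unfolding V_def by (intro AE_finite_allI E.AE_arm_var arms(2)) auto
  moreover have "AE s in Q. \<forall>a\<in>{a. V a = 0}. \<forall>\<^sub>F T in sequentially. arm_mean a T s = mean (P a) \<and> arm_var d a T s = 0"
    by (intro AE_finite_allI E.AE_degenerate_arm arms(2)) (auto simp: V_def)
  ultimately have "AE s in Q. (\<forall>a. (\<lambda>T. arm_mean a T s) \<longlonglongrightarrow> mean (P a)) \<and>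
     (\<forall>a. (\<lambda>T. arm_var d a T s) \<longlonglongrightarrow> V a) \<and>
     (\<forall>a. V a = 0 \<longrightarrow> (\<forall>\<^sub>F T in sequentially. arm_mean a T s = mean (P a) \<and> arm_var d a T s = 0))"
    by eventually_elim auto
  from AE_distrD[OF S this[unfolded Q_def]]
  have data_limits: "AE \<omega> in M. (\<forall>a. (\<lambda>T. arm_mean a T (S \<omega>)) \<longlonglongrightarrow> mean (P a)) \<and>
     (\<forall>a. (\<lambda>T. arm_var d a T (S \<omega>)) \<longlonglongrightarrow> V a) \<and>
     (\<forall>a. V a = 0 \<longrightarrow> (\<forall>\<^sub>F T in sequentially. arm_mean a T (S \<omega>) = mean (P a) \<and> arm_var d a T (S \<omega>) = 0))" .
  define F where "F T \<theta> \<omega> = measure (sim_law \<pi> d a\<^sub>1 T \<theta> (hist A X T \<omega>))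
     {s \<in> space (hist_space T). arm_mean a\<^sub>1 T s \<le> arm_mean a\<^sub>1 T (hist A X T \<omega>)}" for T \<theta> \<omega>
  have "AE \<omega> in M. (\<lambda>B. Fhat a\<^sub>1 T B (hist A X T \<omega>) (\<lambda>\<theta>\<^sub>0 i. sim T \<theta>\<^sub>0 i \<omega>) \<theta>) \<longlonglongrightarrow> F T \<theta> \<omega>"
    if "\<theta> \<in> \<Theta>\<^sub>0" for T \<theta>
  proof -
    have "simulated \<pi> d a\<^sub>1 T M (hist A X T) (\<lambda>_. \<theta>) (\<lambda>i \<omega>. sim T \<theta> i \<omega>)"
      using sim[of "\<lambda>_. \<theta>" T] that by blast
    from AE_Fhat_tendsto[OF design(1) ddof H this] show ?thesis
      unfolding Fhat_def F_def .
  qed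
  then have "AE \<omega> in M. \<forall>T. \<forall>\<theta>\<in>\<Theta>\<^sub>0. (\<lambda>B. Fhat a\<^sub>1 T B (hist A X T \<omega>) (\<lambda>\<theta>\<^sub>0 i. sim T \<theta>\<^sub>0 i \<omega>) \<theta>) \<longlonglongrightarrow> F T \<theta> \<omega>"
    unfolding AE_all_countable by (intro allI AE_finite_allI grid(1))
  with data_limits have "AE \<omega> in M. (\<lambda>T. arm_mean a\<^sub>1 T (S \<omega>)) \<longlonglongrightarrow> mean (P a\<^sub>1) \<and>
     (\<forall>\<^sub>F T in sequentially. \<forall>\<^sub>F B in sequentially.
        Chat a\<^sub>1 T B \<Theta>\<^sub>0 \<alpha> (hist A X T \<omega>) (\<lambda>\<theta>\<^sub>0 i. sim T \<theta>\<^sub>0 i \<omega>) \<subseteq> {arm_mean a\<^sub>1 T (S \<omega>), mean (P a\<^sub>1)})"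
  proof eventually_elim
    case (elim \<omega>)
    have reject: "\<forall>\<^sub>F T in sequentially. F T \<theta> \<omega> \<notin> {\<alpha> / 2..1 - \<alpha> / 2}" if "\<theta> \<noteq> mean (P a\<^sub>1)" for \<theta>
    proof -
      \<comment> \<open>Simulated arm 1 has mean \<theta> at every horizon, so its degenerate case
        concerns the estimated variance alone.\<close>
      define m where "m T a = (if a = a\<^sub>1 then \<theta> else arm_mean a T (S \<omega>))" for T a
      define m' where "m' a = (if a = a\<^sub>1 then \<theta> else mean (P a))" for a
      have "\<forall>\<^sub>F T in sequentially. measure (traj_law \<pi> (\<lambda>a. normal_law (m T a) (arm_var d a T (S \<omega>))) T)
          {h \<in> space (hist_space T). arm_mean a\<^sub>1 T h \<le> arm_mean a\<^sub>1 T (S \<omega>)} \<notin> {\<alpha> / 2..1 - \<alpha> / 2}"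
      proof (rule wrong_null_rejected[where m'=m' and v'=V and \<theta>=\<theta>, OF design])
        show "(\<lambda>T. m T a) \<longlonglongrightarrow> m' a" for a using elim(1) by (auto simp: m_def m'_def)
        show "(\<lambda>T. arm_var d a T (S \<omega>)) \<longlonglongrightarrow> V a" for a using elim(1) by auto
        show "0 \<le> arm_var d a T (S \<omega>)" for T a by (rule arm_var_nonneg[OF ddof])
        show "\<forall>\<^sub>F T in sequentially. m T a = m' a \<and> arm_var d a T (S \<omega>) = 0" if "V a = 0" for a
          using elim(1) that by (auto simp: m_def m'_def elim!: eventually_mono)
        show "m T a\<^sub>1 = \<theta>" for T by (simp add: m_def)
        show "(\<lambda>T. arm_mean a\<^sub>1 T (S \<omega>)) \<longlonglongrightarrow> mean (P a\<^sub>1)" using elim(1) by auto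
      qed (use that level in auto)
      moreover have "sim_arms d a\<^sub>1 T \<theta> (hist A X T \<omega>) = (\<lambda>a. normal_law (m T a) (arm_var d a T (S \<omega>)))" for T
        by (simp add: fun_eq_iff sim_arms_def hist_eq arm_mean_restrict arm_var_restrict m_def)
      ultimately show ?thesis
        by (simp only: F_def sim_law_def hist_eq arm_mean_restrict)
    qed
    have "\<forall>\<^sub>F T in sequentially. \<forall>\<theta>\<in>\<Theta>\<^sub>0. \<theta> \<noteq> mean (P a\<^sub>1) \<longrightarrow> F T \<theta> \<omega> \<notin> {\<alpha> / 2..1 - \<alpha> / 2}"
      using reject by (intro eventually_ball_finite grid(1) ballI) (auto simp: eventually_mono)
    then have "\<forall>\<^sub>F T in sequentially. \<forall>\<^sub>F B in sequentially.
        Chat a\<^sub>1 T B \<Theta>\<^sub>0 \<alpha> (hist A X T \<omega>) (\<lambda>\<theta>\<^sub>0 i. sim T \<theta>\<^sub>0 i \<omega>) \<subseteq> {arm_mean a\<^sub>1 T (S \<omega>), mean (P a\<^sub>1)}"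
    proof eventually_elim
      case (elim T)
      let ?f = "\<lambda>B \<theta>. Fhat a\<^sub>1 T B (hist A X T \<omega>) (\<lambda>\<theta>\<^sub>0 i. sim T \<theta>\<^sub>0 i \<omega>) \<theta>"
      \<comment> \<open>The acceptance interval is closed, so its complement is open and rejection
        by the limit \<open>F\<close> is inherited by \<open>Fhat\<close> for all large B.\<close>
      have "\<forall>\<^sub>F B in sequentially. \<forall>\<theta>\<in>\<Theta>\<^sub>0 - {mean (P a\<^sub>1)}. ?f B \<theta> \<in> - {\<alpha> / 2..1 - \<alpha> / 2}"
      proof (intro eventually_ball_finite ballI)
        fix \<theta> assume \<theta>: "\<theta> \<in> \<Theta>\<^sub>0 - {mean (P a\<^sub>1)}"
        show "\<forall>\<^sub>F B in sequentially. ?f B \<theta> \<in> - {\<alpha> / 2..1 - \<alpha> / 2}"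
        proof (rule topological_tendstoD)
          show "(\<lambda>B. ?f B \<theta>) \<longlonglongrightarrow> F T \<theta> \<omega>"
            using \<open>\<forall>T. \<forall>\<theta>\<in>\<Theta>\<^sub>0. _ T \<theta>\<close> \<theta> by blast
        qed (use elim \<theta> in auto)
      qed (use grid in auto)
      then show ?case
        by eventually_elim (auto simp: Chat_def decision_def hist_eq arm_mean_restrict)
    qed
    with elim(1) show ?case by blast
  qed
  then have main: "AE \<omega> in M. \<omega> \<in> space M \<and> (\<lambda>T. \<bar>arm_mean a\<^sub>1 T (S \<omega>) - mean (P a\<^sub>1)\<bar>) \<longlonglongrightarrow> 0 \<and>
     (\<forall>\<^sub>F T in sequentially. \<forall>\<^sub>F B in sequentially.
        Chat a\<^sub>1 T B \<Theta>\<^sub>0 \<alpha> (hist A X T \<omega>) (\<lambda>\<theta>\<^sub>0 i. sim T \<theta>\<^sub>0 i \<omega>) \<subseteq> {arm_mean a\<^sub>1 T (S \<omega>), mean (P a\<^sub>1)})"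
    using AE_space
  proof eventually_elim
    case (elim \<omega>)
    then have "(\<lambda>T. \<bar>arm_mean a\<^sub>1 T (S \<omega>) - mean (P a\<^sub>1)\<bar>) \<longlonglongrightarrow> \<bar>mean (P a\<^sub>1) - mean (P a\<^sub>1)\<bar>"
      by (intro tendsto_intros) auto
    with elim show ?case by simp
  qed
  have mem: "arm_mean a\<^sub>1 T (S \<omega>) \<in> Chat a\<^sub>1 T B \<Theta>\<^sub>0 \<alpha> (hist A X T \<omega>) s" for T B \<omega> s
    by (simp add: Chat_def hist_eq arm_mean_restrict)
  show ?thesis
  proof
    show "AE \<omega> in M. (\<lambda>T. limsup (\<lambda>B. ereal (hausdorff_dist
            (Chat a\<^sub>1 T B \<Theta>\<^sub>0 \<alpha> (hist A X T \<omega>) (\<lambda>\<theta>\<^sub>0 i. sim T \<theta>\<^sub>0 i \<omega>)) {mean (P a\<^sub>1)}))) \<longlonglongrightarrow> 0"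
      using main
    proof eventually_elim
      case (elim \<omega>)
      show ?case
      proof (rule limsup_tendsto_0I[OF hausdorff_dist_singleton_nonneg])
        show "\<forall>\<^sub>F T in sequentially. \<forall>\<^sub>F B in sequentially. hausdorff_dist
            (Chat a\<^sub>1 T B \<Theta>\<^sub>0 \<alpha> (hist A X T \<omega>) (\<lambda>\<theta>\<^sub>0 i. sim T \<theta>\<^sub>0 i \<omega>)) {mean (P a\<^sub>1)}
             \<le> \<bar>arm_mean a\<^sub>1 T (S \<omega>) - mean (P a\<^sub>1)\<bar>"
          using elim hausdorff_dist_singleton_le[OF mem] by (auto simp: dist_real_def elim!: eventually_mono)
      qed (use elim in auto)
    qed
    show "AE \<omega> in M. (\<lambda>T. limsup (\<lambda>B. ereal \<bar>\<theta>_hat T B \<omega> - mean (P a\<^sub>1)\<bar>)) \<longlonglongrightarrow> 0"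
      using main
    proof eventually_elim
      case (elim \<omega>)
      have "\<theta>_hat T B \<omega> \<in> Chat a\<^sub>1 T B \<Theta>\<^sub>0 \<alpha> (hist A X T \<omega>) (\<lambda>\<theta>\<^sub>0 i. sim T \<theta>\<^sub>0 i \<omega>)" for T B
        using estimate[of \<omega> T B] elim by (auto simp: is_arg_min_def)
      \<comment> \<open>A member of the two-point set is either the observed mean or the true mean
        itself, where the left side is 0.\<close>
      then have le: "\<bar>\<theta>_hat T B \<omega> - mean (P a\<^sub>1)\<bar> \<le> \<bar>arm_mean a\<^sub>1 T (S \<omega>) - mean (P a\<^sub>1)\<bar>"
        if "Chat a\<^sub>1 T B \<Theta>\<^sub>0 \<alpha> (hist A X T \<omega>) (\<lambda>\<theta>\<^sub>0 i. sim T \<theta>\<^sub>0 i \<omega>) \<subseteq> {arm_mean a\<^sub>1 T (S \<omega>), mean (P a\<^sub>1)}" for T B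
        using that by fastforce
      show ?case
      proof (rule limsup_tendsto_0I)
        show "\<forall>\<^sub>F T in sequentially. \<forall>\<^sub>F B in sequentially. \<bar>\<theta>_hat T B \<omega> - mean (P a\<^sub>1)\<bar> \<le> \<bar>arm_mean a\<^sub>1 T (S \<omega>) - mean (P a\<^sub>1)\<bar>"
          using elim le by (auto elim!: eventually_mono)
      qed (use elim in auto)
    qed
  qed
qed

end
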